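(* Let $k\ge 1$ be an integer and let $G=(V,E)$ be a bipartite graph with $n$ vertices and $m$ edges. Consider the following algorithm: for $i=1,\dots,k$, compute a maximum-cardinality matching $M$ in the current graph and delete the edges of $M$ (but not their end-vertices) from the current graph; afterwards, compute a maximum independent set $S$ of the resulting residual graph and output $S$. Then $S$ is a $k$-dependent set of $G$, and if $I^*$ is a maximum-cardinality $k$-dependent set of $G$ then $$\frac{|I^*|}{|S|}\le 1+\frac{k}{k+2},$$ i.e., the algorithm is a $(1+\frac{k}{k+2})$-approximation algorithm for the Maximum $k$-Dependent Set problem on bipartite graphs. Moreover, the algorithm runs in $\mathcal{O}(k m\sqrt{n})$ time.
   Context: All graphs are simple and undirected. For a graph $G=(V,E)$ and an integer $k\ge 0$, a subset $S\subseteq V$ is a $k$-dependent set if every vertex has degree at most $k$ in the subgraph $G[S]$ induced by $S$. The Maximum $k$-Dependent Set problem asks for a $k$-dependent set of maximum cardinality. Whenever several maximum-cardinality matchings or maximum independent sets exist, the algorithm may choose any of them; the approximation guarantee holds for every such choice. For the running time, maximum matchings are computed by the Hopcroft–Karp algorithm, and the maximum independent set of the (bipartite) residual graph is obtained as the complement of a minimum vertex cover derived from a maximum matching. *)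

theory Defs
  imports Complex_Main "HOL-Library.Monad_Syntax"
begin

section \<open>Graphs, matchings, dependent sets\<close>

definition simple_graph :: "'a set \<Rightarrow> 'a set set \<Rightarrow> bool" where
  "simple_graph V E \<longleftrightarrow> finite V \<and> (\<forall>e\<in>E. e \<subseteq> V \<and> card e = 2)"

definition bipartition :: "'a set \<Rightarrow> 'a set set \<Rightarrow> 'a set \<Rightarrow> 'a set \<Rightarrow> bool" where
  "bipartition V E A B \<longleftrightarrow>
     A \<union> B = V \<and> A \<inter> B = {} \<and> (\<forall>e\<in>E. \<exists>a\<in>A. \<exists>b\<in>B. e = {a, b})"

definition bipartite :: "'a set \<Rightarrow> 'a set set \<Rightarrow> bool" where
  "bipartite V E \<longleftrightarrow> (\<exists>A B. bipartition V E A B)"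

definition induced_edges :: "'a set set \<Rightarrow> 'a set \<Rightarrow> 'a set set" where
  "induced_edges E S = {e \<in> E. e \<subseteq> S}"

definition degree :: "'a set set \<Rightarrow> 'a \<Rightarrow> nat" where
  "degree E v = card {e \<in> E. v \<in> e}"

definition k_dependent :: "nat \<Rightarrow> 'a set \<Rightarrow> 'a set set \<Rightarrow> 'a set \<Rightarrow> bool" where
  "k_dependent k V E S \<longleftrightarrow> S \<subseteq> V \<and> (\<forall>v\<in>S. degree (induced_edges E S) v \<le> k)"

definition independent :: "'a set \<Rightarrow> 'a set set \<Rightarrow> 'a set \<Rightarrow> bool" where
  "independent V E S \<longleftrightarrow> S \<subseteq> V \<and> induced_edges E S = {}"

definition matching :: "'a set set \<Rightarrow> 'a set set \<Rightarrow> bool" where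
  "matching E M \<longleftrightarrow> M \<subseteq> E \<and> (\<forall>e\<in>M. \<forall>f\<in>M. e \<noteq> f \<longrightarrow> e \<inter> f = {})"

definition maximum :: "('b set \<Rightarrow> bool) \<Rightarrow> 'b set \<Rightarrow> bool" where
  "maximum P X \<longleftrightarrow> P X \<and> (\<forall>Y. P Y \<longrightarrow> card Y \<le> card X)"


section \<open>The algorithm, with arbitrary choices\<close>

text \<open>\<open>peel i E E'\<close>: some sequence of \<open>i\<close> rounds, each deleting the edges of a maximum matching
  of the current graph, leads from edge set \<open>E\<close> to \<open>E'\<close>.\<close>

inductive peel :: "nat \<Rightarrow> 'a set set \<Rightarrow> 'a set set \<Rightarrow> bool" where
  peel_0: "peel 0 E E"
| peel_Suc: "maximum (matching E) M \<Longrightarrow> peel i (E - M) E' \<Longrightarrow> peel (Suc i) E E'"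

definition algorithm_output :: "nat \<Rightarrow> 'a set \<Rightarrow> 'a set set \<Rightarrow> 'a set \<Rightarrow> bool" where
  "algorithm_output k V E S \<longleftrightarrow> (\<exists>E'. peel k E E' \<and> maximum (independent V E') S)"


section \<open>Cost model\<close>

text \<open>A computation is a result together with its number of steps. Every call of one of the
  programs below is charged one step by \<open>tick\<close>. Apart from calls to other programs, every
  defining equation performs only a bounded number of elementary operations: list
  construction and destruction, comparison and increment of numbers, reading and writing an
  array cell. Arrays indexed by vertices are functions, and writing a cell is function update.
  A new array has unspecified contents; initialising it is paid for cell by cell.\<close>

datatype 'a tm = TM (val: 'a) (steps: nat)

definition bind_tm :: "'a tm \<Rightarrow> ('a \<Rightarrow> 'b tm) \<Rightarrow> 'b tm" where
  "bind_tm m f = TM (val (f (val m))) (steps m + steps (f (val m)))"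

definition return :: "'a \<Rightarrow> 'a tm" where
  "return x = TM x 0"

definition tick :: "'a tm \<Rightarrow> 'a tm" where
  "tick m = TM (val m) (Suc (steps m))"

adhoc_overloading Monad_Syntax.bind \<rightleftharpoons> bind_tm

type_synonym 'b arr = "nat \<Rightarrow> 'b"

fun fill :: "nat list \<Rightarrow> 'b \<Rightarrow> 'b arr \<Rightarrow> 'b arr tm" where
  "fill [] x a = tick (return a)"
| "fill (v # vs) x a = tick (fill vs x (a(v := x)))"

definition new_array :: "nat list \<Rightarrow> 'b \<Rightarrow> 'b arr tm" where
  "new_array vs x = tick (fill vs x (\<lambda>_. undefined))"


section \<open>Input\<close>

text \<open>A bipartite graph with vertices of type \<open>nat\<close> and colour classes \<open>A\<close>, \<open>B\<close> is given by its
  number of vertices, the characteristic array of its vertex set, and a list of its edges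
  without repetition, each stored with its endpoint in \<open>A\<close> first.\<close>

definition edge_list :: "nat set \<Rightarrow> nat set \<Rightarrow> nat set set \<Rightarrow> (nat \<times> nat) list \<Rightarrow> bool" where
  "edge_list A B E es \<longleftrightarrow>
     distinct es \<and> set es \<subseteq> A \<times> B \<and> E = (\<lambda>(u, v). {u, v}) ` set es"

fun lefts :: "(nat \<times> nat) list \<Rightarrow> nat list tm" where
  "lefts [] = tick (return [])"
| "lefts ((u, v) # es) = tick (do { us \<leftarrow> lefts es; return (u # us) })"

fun rights :: "(nat \<times> nat) list \<Rightarrow> nat list tm" where
  "rights [] = tick (return [])"
| "rights ((u, v) # es) = tick (do { vs \<leftarrow> rights es; return (v # vs) })"

fun nub :: "nat list \<Rightarrow> bool arr \<Rightarrow> nat list tm" where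
  "nub [] seen = tick (return [])"
| "nub (x # xs) seen = tick (
     if seen x then nub xs seen
     else do { ys \<leftarrow> nub xs (seen(x := True)); return (x # ys) })"

definition dedup :: "nat list \<Rightarrow> nat list tm" where
  "dedup xs = tick (do { seen \<leftarrow> new_array xs False; nub xs seen })"

fun build_adj :: "(nat \<times> nat) list \<Rightarrow> nat list arr \<Rightarrow> nat list arr tm" where
  "build_adj [] adj = tick (return adj)"
| "build_adj ((u, v) # es) adj = tick (build_adj es (adj(u := v # adj u)))"


section \<open>Hopcroft--Karp\<close>

text \<open>\<open>adj\<close> lists the neighbours of each left vertex; \<open>ml\<close> and \<open>mr\<close> give the mate, if any, of
  each left and right vertex. Breadth-first search along alternating paths from the free left
  vertices sets \<open>lev v = Some d\<close> if the right vertex \<open>v\<close> is first reached from the left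
  vertices of layer \<open>d\<close>; the left vertices of layer \<open>d + 1\<close> are the mates of these \<open>v\<close>.
  The search stops with \<open>Some d\<close> after the first layer \<open>d\<close> reaching a free right vertex, and
  with \<open>None\<close> if there is none.\<close>

fun scan :: "nat \<Rightarrow> nat list \<Rightarrow> nat option arr \<Rightarrow> nat option arr \<times> nat list \<times> bool
    \<Rightarrow> (nat option arr \<times> nat list \<times> bool) tm" where
  "scan d [] mr s = tick (return s)"
| "scan d (v # vs) mr (lev, next, found) = tick (
     if lev v \<noteq> None then scan d vs mr (lev, next, found)
     else case mr v of
       None \<Rightarrow> scan d vs mr (lev(v := Some d), next, True)
     | Some w \<Rightarrow> scan d vs mr (lev(v := Some d), w # next, found))"

fun expand :: "nat \<Rightarrow> nat list \<Rightarrow> nat list arr \<Rightarrow> nat option arr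
    \<Rightarrow> nat option arr \<times> nat list \<times> bool \<Rightarrow> (nat option arr \<times> nat list \<times> bool) tm" where
  "expand d [] adj mr s = tick (return s)"
| "expand d (u # us) adj mr s = tick (do {
     s' \<leftarrow> scan d (adj u) mr s;
     expand d us adj mr s' })"

text \<open>The first argument bounds the number of layers; the number of vertices suffices.\<close>

fun bfs :: "nat \<Rightarrow> nat \<Rightarrow> nat list \<Rightarrow> nat list arr \<Rightarrow> nat option arr \<Rightarrow> nat option arr
    \<Rightarrow> (nat option arr \<times> nat option) tm" where
  "bfs 0 d layer adj mr lev = tick (return (lev, None))"
| "bfs (Suc r) d layer adj mr lev = tick (
     if layer = [] then return (lev, None)
     else do {
       (lev', next, found) \<leftarrow> expand d layer adj mr (lev, [], False);
       if found then return (lev', Some d) else bfs r (Suc d) next adj mr lev' })"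

text \<open>Depth-first search in the layered graph: \<open>dfs r d u vs\<close> looks for an augmenting path
  through the left vertex \<open>u\<close> of layer \<open>d\<close>, continuing to some vertex of \<open>vs\<close>, with \<open>r\<close> layers
  remaining. Visited right vertices are removed from the layered graph. If a path is found, the
  matching is augmented on the way back.\<close>

fun dfs :: "nat \<Rightarrow> nat \<Rightarrow> nat \<Rightarrow> nat list \<Rightarrow> nat list arr
    \<Rightarrow> nat option arr \<times> nat option arr \<times> nat option arr
    \<Rightarrow> (bool \<times> nat option arr \<times> nat option arr \<times> nat option arr) tm" where
  "dfs r d u [] adj (lev, ml, mr) = tick (return (False, lev, ml, mr))"
| "dfs r d u (v # vs) adj (lev, ml, mr) = tick (
     if lev v \<noteq> Some d then dfs r d u vs adj (lev, ml, mr)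
     else case mr v of
       None \<Rightarrow> return (True, lev(v := None), ml(u := Some v), mr(v := Some u))
     | Some w \<Rightarrow> (case r of
         0 \<Rightarrow> dfs r d u vs adj (lev(v := None), ml, mr)
       | Suc r' \<Rightarrow> do {
           (ok, lev', ml', mr') \<leftarrow> dfs r' (Suc d) w (adj w) adj (lev(v := None), ml, mr);
           if ok then return (True, lev', ml'(u := Some v), mr'(v := Some u))
           else dfs r d u vs adj (lev', ml', mr') }))"

fun augment :: "nat \<Rightarrow> nat list \<Rightarrow> nat list arr
    \<Rightarrow> nat option arr \<times> nat option arr \<times> nat option arr
    \<Rightarrow> (nat option arr \<times> nat option arr \<times> nat option arr) tm" where
  "augment r [] adj s = tick (return s)"
| "augment r (u # us) adj (lev, ml, mr) = tick (
     if ml u \<noteq> None then augment r us adj (lev, ml, mr)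
     else do {
       (ok, s') \<leftarrow> dfs r 0 u (adj u) adj (lev, ml, mr);
       augment r us adj s' })"

fun free_vertices :: "nat list \<Rightarrow> nat option arr \<Rightarrow> nat list tm" where
  "free_vertices [] ml = tick (return [])"
| "free_vertices (u # us) ml = tick (do {
     fs \<leftarrow> free_vertices us ml;
     return (if ml u = None then u # fs else fs) })"

text \<open>The first argument bounds the number of phases; the number \<open>n\<close> of vertices suffices. The
  result contains, besides the matching, the levels of the last, unsuccessful search.\<close>

fun phases :: "nat \<Rightarrow> nat \<Rightarrow> nat list \<Rightarrow> nat list \<Rightarrow> nat list arr \<Rightarrow> nat option arr
    \<Rightarrow> nat option arr \<Rightarrow> (nat option arr \<times> nat option arr \<times> nat option arr) tm" where
  "phases 0 n ls rs adj ml mr = tick (return (\<lambda>_. undefined, ml, mr))"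
| "phases (Suc r) n ls rs adj ml mr = tick (do {
     lev \<leftarrow> new_array rs None;
     layer \<leftarrow> free_vertices ls ml;
     (lev', len) \<leftarrow> bfs n 0 layer adj mr lev;
     case len of
       None \<Rightarrow> return (lev', ml, mr)
     | Some d \<Rightarrow> do {
         (lev'', ml', mr') \<leftarrow> augment d ls adj (lev', ml, mr);
         phases r n ls rs adj ml' mr' } })"

definition hopcroft_karp :: "nat \<Rightarrow> nat list \<Rightarrow> nat list \<Rightarrow> (nat \<times> nat) list
    \<Rightarrow> (nat option arr \<times> nat option arr \<times> nat option arr) tm" where
  "hopcroft_karp n ls rs es = tick (do {
     adj \<leftarrow> new_array ls [];
     adj' \<leftarrow> build_adj es adj;
     ml \<leftarrow> new_array ls None;
     mr \<leftarrow> new_array rs None;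
     phases n n ls rs adj' ml mr })"


section \<open>Implementation of the algorithm\<close>

fun delete_matching :: "nat option arr \<Rightarrow> (nat \<times> nat) list \<Rightarrow> (nat \<times> nat) list tm" where
  "delete_matching ml [] = tick (return [])"
| "delete_matching ml ((u, v) # es) = tick (do {
     es' \<leftarrow> delete_matching ml es;
     return (if ml u = Some v then es' else (u, v) # es') })"

fun peel_edges :: "nat \<Rightarrow> nat \<Rightarrow> nat list \<Rightarrow> nat list \<Rightarrow> (nat \<times> nat) list
    \<Rightarrow> (nat \<times> nat) list tm" where
  "peel_edges 0 n ls rs es = tick (return es)"
| "peel_edges (Suc i) n ls rs es = tick (do {
     (lev, ml, mr) \<leftarrow> hopcroft_karp n ls rs es;
     es' \<leftarrow> delete_matching ml es;
     peel_edges i n ls rs es' })"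

text \<open>The minimum vertex cover derived from a maximum matching consists of the left vertices
  that cannot, and the right vertices that can, be reached from free left vertices along
  alternating paths. A left vertex is reachable iff it is free or its mate is reachable. The
  cover is deleted from the characteristic array of the vertex set.\<close>

fun remove_left_cover :: "nat option arr \<Rightarrow> nat option arr \<Rightarrow> nat list \<Rightarrow> bool arr
    \<Rightarrow> bool arr tm" where
  "remove_left_cover lev ml [] s = tick (return s)"
| "remove_left_cover lev ml (u # us) s = tick (
     case ml u of
       None \<Rightarrow> remove_left_cover lev ml us s
     | Some v \<Rightarrow> remove_left_cover lev ml us (if lev v = None then s(u := False) else s))"

fun remove_right_cover :: "nat option arr \<Rightarrow> nat list \<Rightarrow> bool arr \<Rightarrow> bool arr tm" where
  "remove_right_cover lev [] s = tick (return s)"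
| "remove_right_cover lev (v # vs) s = tick (
     remove_right_cover lev vs (if lev v \<noteq> None then s(v := False) else s))"

definition peeling_algorithm :: "nat \<Rightarrow> nat \<Rightarrow> bool arr \<Rightarrow> (nat \<times> nat) list \<Rightarrow> bool arr tm" where
  "peeling_algorithm k n vertices es = tick (do {
     us \<leftarrow> lefts es;
     ls \<leftarrow> dedup us;
     vs \<leftarrow> rights es;
     rs \<leftarrow> dedup vs;
     es' \<leftarrow> peel_edges k n ls rs es;
     (lev, ml, mr) \<leftarrow> hopcroft_karp n ls rs es';
     s \<leftarrow> remove_left_cover lev ml ls vertices;
     remove_right_cover lev rs s })"

end

theory Submission
  imports Defs
begin

text \<open>
  Let \<open>I\<close> be \<open>k\<close>-dependent, \<open>t = |V - I|\<close>, and let \<open>\<nu>\<close> be the matching number of the residual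
  graph, so that \<open>|S| = |V| - \<nu>\<close> by Koenig's theorem. The \<open>k\<close> deleted matchings and a maximum
  matching of the residual graph are disjoint, have at least \<open>\<nu>\<close> edges each, and each has at most \<open>t\<close>
  edges leaving \<open>I\<close>. Hence \<open>(k + 1) (\<nu> - t)\<close> is at most the number of edges inside \<open>I\<close>, which is
  at most \<open>k |I| / 2\<close>, and this rearranges to \<open>(k + 2) |I| \<le> (2 k + 2) |S|\<close>.

  For the running time of Hopcroft--Karp, the breadth-first layers play the role of the shortest
  augmenting paths. The level \<open>d\<close> at which a free right vertex is found increases in every phase.
  For each \<open>j < d\<close>, the left vertices not in the layers up to \<open>j\<close> together with the right vertices of
  level at most \<open>j\<close> form a vertex cover whose size exceeds that of the current matching by the size
  of layer \<open>j\<close>. Thus at most \<open>n / d\<close> edges are missing, and there are at most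
  \<open>s + n / s + 1\<close> phases for every \<open>s > 0\<close>. When no free right vertex is reached, the same
  construction gives a vertex cover of the size of the matching.
\<close>

section \<open>Array and list programs\<close>

lemma val_bind [simp]: "val (bind_tm m f) = val (f (val m))"
  and steps_bind [simp]: "steps (bind_tm m f) = steps m + steps (f (val m))"
  by (simp_all add: bind_tm_def)

lemma val_return [simp]: "val (return x) = x"
  and steps_return [simp]: "steps (return x) = 0"
  by (simp_all add: return_def)

lemma val_tick [simp]: "val (tick m) = val m"
  and steps_tick [simp]: "steps (tick m) = Suc (steps m)"
  by (simp_all add: tick_def)

lemma val_fill: "val (fill vs x a) v = (if v \<in> set vs then x else a v)"
  by (induction vs arbitrary: a) auto

lemma steps_fill [simp]: "steps (fill vs x a) = length vs + 1"
  by (induction vs arbitrary: a) auto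

lemma val_new_array: "v \<in> set vs \<Longrightarrow> val (new_array vs x) v = x"
  by (simp add: new_array_def val_fill)

lemma steps_new_array [simp]: "steps (new_array vs x) = length vs + 2"
  by (simp add: new_array_def)

lemma lefts [simp]: "val (lefts es) = map fst es" "steps (lefts es) = length es + 1"
  by (induction es rule: lefts.induct) auto

lemma rights [simp]: "val (rights es) = map snd es" "steps (rights es) = length es + 1"
  by (induction es rule: rights.induct) auto

lemma nub:
  "set (val (nub xs seen)) = {x \<in> set xs. \<not> seen x}"
  "distinct (val (nub xs seen))"
  "length (val (nub xs seen)) \<le> length xs"
  "steps (nub xs seen) = length xs + 1"
  by (induction xs seen rule: nub.induct) (auto simp: le_SucI)

lemma dedup:
  "set (val (dedup xs)) = set xs"
  "distinct (val (dedup xs))"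
  "length (val (dedup xs)) \<le> length xs"
  "steps (dedup xs) = 2 * length xs + 4"
  by (auto simp: dedup_def nub val_new_array)

lemma set_build_adj:
  "set (val (build_adj es adj) u) = set (adj u) \<union> {v. (u, v) \<in> set es}"
  by (induction es arbitrary: adj) (auto split: if_splits)

lemma length_build_adj:
  "length (val (build_adj es adj) u) = length (adj u) + length (filter (\<lambda>e. fst e = u) es)"
  by (induction es arbitrary: adj) (auto split: if_splits)

lemma steps_build_adj [simp]: "steps (build_adj es adj) = length es + 1"
  by (induction es arbitrary: adj) (auto split: if_splits)

lemma free_vertices [simp]:
  "val (free_vertices us ml) = filter (\<lambda>u. ml u = None) us"
  "steps (free_vertices us ml) = length us + 1"
  by (induction us ml rule: free_vertices.induct) auto

lemma delete_matching [simp]: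
  "val (delete_matching ml es) = filter (\<lambda>(u, v). ml u \<noteq> Some v) es"
  "steps (delete_matching ml es) = length es + 1"
  by (induction ml es rule: delete_matching.induct) auto

lemma remove_left_cover:
  "val (remove_left_cover lev ml us s) x \<longleftrightarrow>
     s x \<and> \<not> (x \<in> set us \<and> (\<exists>v. ml x = Some v \<and> lev v = None))"
  "steps (remove_left_cover lev ml us s) = length us + 1"
  by (induction lev ml us s rule: remove_left_cover.induct) (auto split: option.split)

lemma remove_right_cover:
  "val (remove_right_cover lev vs s) x \<longleftrightarrow> s x \<and> \<not> (x \<in> set vs \<and> lev x \<noteq> None)"
  "steps (remove_right_cover lev vs s) = length vs + 1"
  by (induction lev vs s rule: remove_right_cover.induct) auto

section \<open>Matchings as arrays of mates\<close>

text \<open>The layer of a left vertex in breadth-first search. The program stores levels of right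
  vertices only, so the layer is recovered from the mate: free vertices form layer 0, all others
  come one after the level of their mate.\<close>

definition ldist :: "nat option arr \<Rightarrow> nat option arr \<Rightarrow> nat \<Rightarrow> nat option" where
  "ldist ml lev u = (case ml u of None \<Rightarrow> Some 0 | Some v \<Rightarrow> map_option Suc (lev v))"

locale adjacency =
  fixes ls rs :: "nat list" and adj :: "nat list arr"
  assumes distinct_ls: "distinct ls" and distinct_rs: "distinct rs"
    and adj_rs: "u \<in> set ls \<Longrightarrow> set (adj u) \<subseteq> set rs"
begin

abbreviation "L \<equiv> set ls"
abbreviation "R \<equiv> set rs"

text \<open>The two arrays are required to be inverse to each other on \<open>L\<close> and
  \<open>R\<close> only; outside of these sets a new array has unspecified contents.\<close>

definition mates :: "nat option arr \<Rightarrow> nat option arr \<Rightarrow> bool" where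
  "mates ml mr \<longleftrightarrow>
     (\<forall>u\<in>L. \<forall>v. ml u = Some v \<longrightarrow> v \<in> set (adj u) \<and> mr v = Some u) \<and>
     (\<forall>v\<in>R. \<forall>u. mr v = Some u \<longrightarrow> u \<in> L \<and> ml u = Some v)"

text \<open>Injectivity of the two projections expresses that distinct edges share neither a left
  nor a right end.\<close>

definition pair_matching :: "(nat \<times> nat) set \<Rightarrow> bool" where
  "pair_matching N \<longleftrightarrow> (\<forall>(u, v)\<in>N. u \<in> L \<and> v \<in> set (adj u)) \<and> inj_on fst N \<and> inj_on snd N"

definition matched :: "nat option arr \<Rightarrow> nat set" where
  "matched ml = {u \<in> L. ml u \<noteq> None}"

lemma mates_left:
  assumes "mates ml mr" "u \<in> L" "ml u = Some v"
  shows "v \<in> set (adj u)" "v \<in> R" "mr v = Some u"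
  using assms adj_rs unfolding mates_def by blast+

lemma mates_right:
  assumes "mates ml mr" "v \<in> R" "mr v = Some u"
  shows "u \<in> L" "ml u = Some v" "v \<in> set (adj u)"
  using assms unfolding mates_def by blast+

text \<open>Reindexing along the bijection between matched right vertices and their mates. It turns
  costs charged to right vertices into sums over adjacency lists.\<close>

lemma sum_mates:
  assumes "mates ml mr"
  shows "(\<Sum>v\<in>R. case mr v of None \<Rightarrow> 0 | Some w \<Rightarrow> g w) = (\<Sum>u\<in>matched ml. g u :: nat)"
proof -
  have "(\<Sum>v\<in>R. case mr v of None \<Rightarrow> 0 | Some w \<Rightarrow> g w)
      = (\<Sum>v\<in>{v \<in> R. mr v \<noteq> None}. g (the (mr v)))"
    by (rule sum.mono_neutral_cong_right) auto
  also have "\<dots> = (\<Sum>u\<in>matched ml. g u)"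
  proof (rule sum.reindex_bij_witness[of _ "\<lambda>u. the (ml u)" "\<lambda>v. the (mr v)"])
    fix v assume "v \<in> {v \<in> R. mr v \<noteq> None}"
    then obtain u where "v \<in> R" "mr v = Some u" by blast
    with mates_right[OF assms this] show "the (ml (the (mr v))) = v" "the (mr v) \<in> matched ml"
      by (auto simp: matched_def)
  next
    fix u assume "u \<in> matched ml"
    then obtain v where "u \<in> L" "ml u = Some v" by (auto simp: matched_def)
    with mates_left[OF assms this]
    show "the (mr (the (ml u))) = u" "the (ml u) \<in> {v \<in> R. mr v \<noteq> None}" by auto
  qed simp
  finally show ?thesis .
qed

text \<open>Every matching edge contributes exactly one vertex: its right end if that lies in
  \<open>Z\<close>, and its left end otherwise.\<close>

lemma card_cover:
  assumes m: "mates ml mr" and Z: "Z \<subseteq> R" "\<And>v. v \<in> Z \<Longrightarrow> mr v \<noteq> None"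
  shows "card {u \<in> L. \<exists>v. ml u = Some v \<and> v \<notin> Z} + card Z = card (matched ml)"
proof -
  have Z': "\<exists>u\<in>L. mr v = Some u \<and> ml u = Some v" if v: "v \<in> Z" for v
  proof -
    obtain u where "mr v = Some u" using Z(2)[OF v] by blast
    then show ?thesis using mates_right[OF m, of v u] v Z(1) by blast
  qed
  have "bij_betw (\<lambda>v. the (mr v)) Z {u \<in> L. \<exists>v. ml u = Some v \<and> v \<in> Z}"
    by (rule bij_betw_byWitness[of _ "\<lambda>u. the (ml u)"]) (force dest: Z' mates_left(3)[OF m])+
  then have "card Z = card {u \<in> L. \<exists>v. ml u = Some v \<and> v \<in> Z}" by (rule bij_betw_same_card)
  moreover have "matched ml = {u \<in> L. \<exists>v. ml u = Some v \<and> v \<notin> Z} \<union> {u \<in> L. \<exists>v. ml u = Some v \<and> v \<in> Z}"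
    by (auto simp: matched_def)
  moreover have "card ({u \<in> L. \<exists>v. ml u = Some v \<and> v \<notin> Z} \<union> {u \<in> L. \<exists>v. ml u = Some v \<and> v \<in> Z})
     = card {u \<in> L. \<exists>v. ml u = Some v \<and> v \<notin> Z} + card {u \<in> L. \<exists>v. ml u = Some v \<and> v \<in> Z}"
    by (intro card_Un_disjoint) auto
  ultimately show ?thesis by simp
qed

text \<open>With \<open>Y = Z\<close> the set of all reached right vertices this shows optimality; with \<open>Y\<close> and \<open>Z\<close>
  the right vertices of level \<open>< j\<close> and \<open>\<le> j\<close> it bounds the number of missing edges by the size of
  layer \<open>j\<close>.\<close>

lemma cover_bound:
  assumes m: "mates ml mr" and Y: "Y \<subseteq> R" "\<And>v. v \<in> Y \<Longrightarrow> mr v \<noteq> None" and Z: "Z \<subseteq> R"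
    and closed: "\<And>u v. u \<in> L \<Longrightarrow> (\<forall>y. ml u = Some y \<longrightarrow> y \<in> Y) \<Longrightarrow> v \<in> set (adj u) \<Longrightarrow> v \<in> Z"
    and N: "pair_matching N"
  shows "card N + card Y \<le> card (matched ml) + card Z"
proof -
  let ?U = "{u \<in> L. \<exists>v. ml u = Some v \<and> v \<notin> Y}"
  let ?N1 = "{e \<in> N. fst e \<in> ?U}" and ?N2 = "{e \<in> N. snd e \<in> Z}"
  have inj: "inj_on fst N" "inj_on snd N" using N by (auto simp: pair_matching_def)
  \<comment> \<open>A left end outside \<open>?U\<close> is free or has its mate in
    \<open>Y\<close>, so \<open>closed\<close> puts the right end into \<open>Z\<close>.\<close>
  have "N \<subseteq> ?N1 \<union> ?N2"
    using N closed by (fastforce simp: pair_matching_def)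
  moreover have fin: "finite ?N1" "finite ?N2"
  proof -
    show "finite ?N1" using inj(1) by (intro inj_on_finite[of fst ?N1 ?U]) (auto intro: inj_on_subset)
    show "finite ?N2" using inj(2) Z by (intro inj_on_finite[of snd ?N2 Z])
       (auto intro: inj_on_subset finite_subset)
  qed
  ultimately have "card N \<le> card (?N1 \<union> ?N2)" by (intro card_mono) auto
  also have "\<dots> \<le> card ?N1 + card ?N2" by (rule card_Un_le)
  also have "card ?N1 \<le> card ?U"
    using inj(1) by (intro card_inj_on_le[of fst]) (auto intro: inj_on_subset)
  also have "card ?N2 \<le> card Z"
    using inj(2) Z by (intro card_inj_on_le[of snd]) (auto intro: inj_on_subset finite_subset)
  finally show ?thesis using card_cover[OF m Y] by simp
qed

end

section \<open>Breadth-first search\<close>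

definition fresh :: "nat option arr \<Rightarrow> nat set \<Rightarrow> nat set" where
  "fresh lev X = {v \<in> X. lev v = None}"

text \<open>A vertex has a level after its first occurrence in \<open>vs\<close> and is skipped from
  then on, so the outcome depends on sets only.\<close>

lemma scan:
  assumes "val (scan d vs mr (lev, next, found)) = (lev', next', found')"
  shows "lev' = (\<lambda>v. if v \<in> fresh lev (set vs) then Some d else lev v) \<and>
    set next' = set next \<union> {w. \<exists>v\<in>fresh lev (set vs). mr v = Some w} \<and>
    (found' \<longleftrightarrow> found \<or> (\<exists>v\<in>fresh lev (set vs). mr v = None))"
  using assms
proof (induction vs arbitrary: lev "next" found)
  case Nil
  then show ?case by (simp add: fresh_def)
next
  case (Cons v vs)
  show ?case
  proof (cases "lev v = None")
    case False
    then have "val (scan d vs mr (lev, next, found)) = (lev', next', found')"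
      using Cons.prems by simp
    moreover have "fresh lev (set (v # vs)) = fresh lev (set vs)"
      using False by (auto simp: fresh_def)
    ultimately show ?thesis using Cons.IH by presburger
  next
    case True
    have fresh: "fresh lev (set (v # vs)) = insert v (fresh (lev(v := Some d)) (set vs))"
      using True by (auto simp: fresh_def)
    \<comment> \<open>The free and the matched case of \<open>v\<close> are merged here, so that the
      induction hypothesis is applied once.\<close>
    obtain next1 found1 where
      1: "val (scan d vs mr (lev(v := Some d), next1, found1)) = (lev', next', found')"
      and "set next1 = set next \<union> {w. mr v = Some w}" "found1 \<longleftrightarrow> found \<or> mr v = None"
      using Cons.prems True by (cases "mr v") fastforce+
    with Cons.IH[OF 1] show ?thesis
      unfolding fresh by (auto simp del: fun_upd_apply simp: fun_upd_def)
  qed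
qed

lemma steps_scan [simp]: "steps (scan d vs mr s) = length vs + 1"
  by (induction d vs mr s rule: scan.induct) (auto split: option.split)

section \<open>Breadth-first search over whole layers: cost and invariant\<close>

context adjacency begin

lemma expand:
  assumes "val (expand d us adj mr (lev, next, found)) = (lev', next', found')"
  shows "lev' = (\<lambda>v. if v \<in> fresh lev (\<Union>u\<in>set us. set (adj u)) then Some d else lev v) \<and>
    set next' = set next \<union> {w. \<exists>v\<in>fresh lev (\<Union>u\<in>set us. set (adj u)). mr v = Some w} \<and>
    (found' \<longleftrightarrow> found \<or> (\<exists>v\<in>fresh lev (\<Union>u\<in>set us. set (adj u)). mr v = None))"
  using assms
proof (induction us arbitrary: lev "next" found)
  case Nil
  then show ?case by (simp add: fresh_def)
next
  case (Cons u us)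
  obtain lev1 next1 found1 where
    1: "val (scan d (adj u) mr (lev, next, found)) = (lev1, next1, found1)"
    by (metis prod_cases3)
  have 2: "val (expand d us adj mr (lev1, next1, found1)) = (lev', next', found')"
    using Cons.prems 1 by simp
  let ?X = "fresh lev (set (adj u))" and ?Y = "fresh lev1 (\<Union>u\<in>set us. set (adj u))"
  have fresh: "fresh lev (\<Union>u\<in>set (u # us). set (adj u)) = ?X \<union> ?Y"
    using scan[OF 1] by (auto simp: fresh_def split: if_splits)
  show ?case
    unfolding fresh
  proof (intro conjI)
    have "lev1 v = (if v \<in> ?X then Some d else lev v)" for v using scan[OF 1] by simp
    moreover have "lev' v = (if v \<in> ?Y then Some d else lev1 v)" for v using Cons.IH[OF 2] by simp
    ultimately show "lev' = (\<lambda>v. if v \<in> ?X \<union> ?Y then Some d else lev v)"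
      by auto
    show "set next' = set next \<union> {w. \<exists>v\<in>?X \<union> ?Y. mr v = Some w}"
      using scan[OF 1, THEN conjunct2, THEN conjunct1]
        Cons.IH[OF 2, THEN conjunct2, THEN conjunct1] by blast
    show "found' \<longleftrightarrow> found \<or> (\<exists>v\<in>?X \<union> ?Y. mr v = None)"
      using scan[OF 1, THEN conjunct2, THEN conjunct2]
        Cons.IH[OF 2, THEN conjunct2, THEN conjunct2] by blast
  qed
qed

lemma steps_expand: "steps (expand d us adj mr s) = (\<Sum>u\<leftarrow>us. length (adj u) + 2) + 1"
  by (induction us arbitrary: s) auto

text \<open>Expanding \<open>u\<close> takes \<open>length (adj u) + 2\<close> steps. The other 2
  are a reserve for the call of \<open>bfs\<close> and the final call of \<open>expand\<close>,
  which occur once per layer and are charged to one vertex of the nonempty layer.\<close>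

definition weight :: "nat \<Rightarrow> nat" where
  "weight u = length (adj u) + 4"

text \<open>The cost of expanding a left vertex is charged to its mate, which becomes seen only once.\<close>

definition unseen_weight :: "nat option arr \<Rightarrow> nat option arr \<Rightarrow> nat" where
  "unseen_weight mr lev = (\<Sum>v\<in>fresh lev R. case mr v of None \<Rightarrow> 0 | Some w \<Rightarrow> weight w)"

lemma unseen_weight_update:
  assumes "v \<in> R" "lev v = None"
  shows "unseen_weight mr lev
    = (case mr v of None \<Rightarrow> 0 | Some w \<Rightarrow> weight w) + unseen_weight mr (lev(v := Some d))"
proof -
  have "fresh (lev(v := Some d)) R = fresh lev R - {v}" by (auto simp: fresh_def)
  moreover have "v \<in> fresh lev R" using assms by (simp add: fresh_def)
  ultimately show ?thesis
    unfolding unseen_weight_def by (simp add: sum.remove fresh_def)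
qed

text \<open>Giving \<open>v\<close> a level moves the weight of its mate from the unseen part to
  \<open>next\<close>. Since \<open>next\<close> is summed as a list, repeated entries would be
  counted too.\<close>

lemma scan_weight:
  assumes "set vs \<subseteq> R" "val (scan d vs mr (lev, next, found)) = (lev', next', found')"
  shows "(\<Sum>u\<leftarrow>next'. weight u) + unseen_weight mr lev'
    = (\<Sum>u\<leftarrow>next. weight u) + unseen_weight mr lev"
  using assms
proof (induction vs arbitrary: lev "next" found)
  case (Cons v vs)
  show ?case
  proof (cases "lev v = None")
    case True
    note IH = Cons.IH[of "lev(v := Some d)"]
    show ?thesis
      using Cons.prems True unseen_weight_update[of v lev mr d] IH[of "next" True]
        IH[of "the (mr v) # next" found]
      by (cases "mr v") (auto simp del: fun_upd_apply)
  next
    case False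
    then show ?thesis using Cons.prems Cons.IH[of lev] by auto
  qed
qed auto

lemma expand_weight:
  assumes "set us \<subseteq> L" "val (expand d us adj mr (lev, next, found)) = (lev', next', found')"
  shows "(\<Sum>u\<leftarrow>next'. weight u) + unseen_weight mr lev'
    = (\<Sum>u\<leftarrow>next. weight u) + unseen_weight mr lev"
  using assms
proof (induction us arbitrary: lev "next" found)
  case (Cons u us)
  obtain lev1 next1 found1 where
    1: "val (scan d (adj u) mr (lev, next, found)) = (lev1, next1, found1)"
    by (metis prod_cases3)
  have "val (expand d us adj mr (lev1, next1, found1)) = (lev', next', found')"
    using Cons.prems 1 by simp
  then show ?case
    using Cons.IH Cons.prems scan_weight[OF _ 1] adj_rs by simp
qed simp

text \<open>Breadth-first search has been completed for all layers below \<open>d\<close>.\<close>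

definition layered :: "nat option arr \<Rightarrow> nat option arr \<Rightarrow> nat \<Rightarrow> bool" where
  "layered ml lev d \<longleftrightarrow>
     (\<forall>v\<in>R. \<forall>j. lev v = Some j \<longrightarrow> j < d \<and> (\<exists>u\<in>L. v \<in> set (adj u) \<and> ldist ml lev u = Some j)) \<and>
     (\<forall>u\<in>L. \<forall>i<d. ldist ml lev u = Some i \<longrightarrow> (\<forall>v\<in>set (adj u). \<exists>j\<le>i. lev v = Some j))"

lemma layered_right:
  assumes "layered ml lev d" "v \<in> R" "lev v = Some j"
  shows "j < d" "\<exists>u\<in>L. v \<in> set (adj u) \<and> ldist ml lev u = Some j"
  using assms by (auto simp: layered_def)

lemma layered_left:
  assumes "layered ml lev d" "u \<in> L" "ldist ml lev u = Some i" "i < d" "v \<in> set (adj u)"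
  obtains j where "lev v = Some j" "j \<le> i"
  using assms unfolding layered_def by blast

text \<open>A newly reached vertex had no level before, and its mate enters layer
  \<open>Suc d\<close>. Hence the layers up to \<open>d\<close> stay as they are, and the invariant
  extends by one layer.\<close>

lemma layered_expand:
  assumes m: "mates ml mr" and lay: "layered ml lev d"
    and layer: "set layer = {u \<in> L. ldist ml lev u = Some d}"
    and X: "X = fresh lev (\<Union>u\<in>set layer. set (adj u))"
    and lev': "lev' = (\<lambda>v. if v \<in> X then Some d else lev v)"
  shows "\<And>u i. u \<in> L \<Longrightarrow> i \<le> d \<Longrightarrow> ldist ml lev' u = Some i \<longleftrightarrow> ldist ml lev u = Some i"
    and "layered ml lev' (Suc d)"
    and "{u \<in> L. ldist ml lev' u = Some (Suc d)} = {w. \<exists>v\<in>X. mr v = Some w}"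
proof -
  have XR: "X \<subseteq> R" using layer adj_rs by (auto simp: X fresh_def)
  have XN: "lev v = None" if "v \<in> X" for v using that by (auto simp: X fresh_def)
  have ld: "ldist ml lev' u = Some i \<longleftrightarrow> ldist ml lev u = Some i" if "u \<in> L" "i \<le> d" for u i
    using that XN by (auto simp: ldist_def lev' split: option.split)
  show "\<And>u i. u \<in> L \<Longrightarrow> i \<le> d \<Longrightarrow> ldist ml lev' u = Some i \<longleftrightarrow> ldist ml lev u = Some i"
    by (rule ld)
  show "layered ml lev' (Suc d)"
    unfolding layered_def
  proof (intro conjI ballI allI impI)
    fix v j assume v: "v \<in> R" "lev' v = Some j"
    show "j < Suc d"
      using v layered_right(1)[OF lay v(1)] by (cases "v \<in> X") (auto simp: lev' less_SucI)
    show "\<exists>u\<in>L. v \<in> set (adj u) \<and> ldist ml lev' u = Some j"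
    proof (cases "v \<in> X")
      case True
      then have "\<exists>u\<in>set layer. v \<in> set (adj u)" by (auto simp: X fresh_def)
      then show ?thesis using layer ld v True by (auto simp: lev')
    next
      case False
      then have "lev v = Some j" using v by (simp add: lev')
      with layered_right[OF lay v(1)] ld show ?thesis by (meson less_imp_le)
    qed
  next
    fix u i v assume u: "u \<in> L" "i < Suc d" "ldist ml lev' u = Some i" and v: "v \<in> set (adj u)"
    have vR: "v \<in> R" using u(1) v adj_rs by blast
    have ui: "ldist ml lev u = Some i" using u ld by simp
    show "\<exists>j\<le>i. lev' v = Some j"
    proof (cases "lev v")
      case None
      have "i = d"
      proof (rule ccontr)
        assume "i \<noteq> d"
        then have "i < d" using u(2) by simp
        from layered_left[OF lay u(1) ui this v] None show False by auto
      qed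
      then have "v \<in> X" using None layer u ui v by (auto simp: X fresh_def)
      then show ?thesis using \<open>i = d\<close> by (simp add: lev')
    next
      case (Some j)
      then have "lev' v = Some j" using XN by (auto simp: lev')
      moreover have "j \<le> i"
      proof (cases "i = d")
        case True
        then show ?thesis using layered_right(1)[OF lay vR Some] by simp
      next
        case False
        then have "i < d" using u(2) by simp
        from layered_left[OF lay u(1) ui this v] Some show ?thesis by auto
      qed
      ultimately show ?thesis by blast
    qed
  qed
  show "{u \<in> L. ldist ml lev' u = Some (Suc d)} = {w. \<exists>v\<in>X. mr v = Some w}"
  proof (intro set_eqI iffI)
    fix u assume "u \<in> {u \<in> L. ldist ml lev' u = Some (Suc d)}"
    then obtain v where u: "u \<in> L" "ml u = Some v" "lev' v = Some d"
      by (auto simp: ldist_def split: option.splits)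
    have "mr v = Some u" "v \<in> R" using mates_left[OF m u(1,2)] by auto
    \<comment> \<open>Old levels are below \<open>d\<close>, so level \<open>d\<close> marks a newly
      reached vertex.\<close>
    moreover have "v \<in> X"
      using u(3) layered_right(1)[OF lay \<open>v \<in> R\<close>] by (auto simp: lev' split: if_splits)
    ultimately show "u \<in> {w. \<exists>v\<in>X. mr v = Some w}" by blast
  next
    fix u assume "u \<in> {w. \<exists>v\<in>X. mr v = Some w}"
    then obtain v where v: "v \<in> X" "mr v = Some u" by blast
    have "u \<in> L" "ml u = Some v" using mates_right[OF m _ v(2)] v(1) XR by auto
    then show "u \<in> {u \<in> L. ldist ml lev' u = Some (Suc d)}"
      using v by (simp add: ldist_def lev')
  qed
qed

text \<open>The fuel \<open>r\<close> bounds the number of left vertices outside the layers below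
  \<open>d\<close>, which drops with each nonempty layer. The search stops at the first layer
  reaching a free right vertex, so all free right vertices with a level are on that last
  level.\<close>

lemma bfs:
  assumes m: "mates ml mr" and "layered ml lev d"
    and "\<forall>v\<in>R. lev v \<noteq> None \<longrightarrow> mr v \<noteq> None"
    and "set layer = {u \<in> L. ldist ml lev u = Some d}"
    and "card {u \<in> L. \<forall>i<d. ldist ml lev u \<noteq> Some i} \<le> r"
    and "val (bfs r d layer adj mr lev) = (lev', res)"
  shows "case res of
      None \<Rightarrow> (\<exists>d'. layered ml lev' d' \<and> {u \<in> L. ldist ml lev' u = Some d'} = {}) \<and>
        (\<forall>v\<in>R. lev' v \<noteq> None \<longrightarrow> mr v \<noteq> None)
    | Some d' \<Rightarrow> layered ml lev' (Suc d') \<and>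
        (\<forall>v\<in>R. mr v = None \<longrightarrow> lev' v = None \<or> lev' v = Some d') \<and>
        (\<exists>v\<in>R. mr v = None \<and> lev' v = Some d')"
  using assms(2-)
proof (induction r arbitrary: d layer lev)
  case 0
  \<comment> \<open>Without fuel every left vertex lies in a layer below \<open>d\<close>, so layer
    \<open>d\<close> is empty and giving up is justified.\<close>
  then have "{u \<in> L. \<forall>i<d. ldist ml lev u \<noteq> Some i} = {}" by simp
  then have "{u \<in> L. ldist ml lev u = Some d} = {}" by auto
  then show ?case using 0 by auto
next
  case (Suc r)
  show ?case
  proof (cases "layer = []")
    case True
    then show ?thesis using Suc.prems by auto
  next
    case False
    obtain lev1 next1 found1 where
      1: "val (expand d layer adj mr (lev, [], False)) = (lev1, next1, found1)"
      by (metis prod_cases3)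
    define X where "X = fresh lev (\<Union>u\<in>set layer. set (adj u))"
    have ex: "lev1 = (\<lambda>v. if v \<in> X then Some d else lev v)"
      "set next1 = {w. \<exists>v\<in>X. mr v = Some w}" "found1 \<longleftrightarrow> (\<exists>v\<in>X. mr v = None)"
      using expand[OF 1] by (simp_all add: X_def)
    note lay = layered_expand[OF m Suc.prems(1,3) X_def ex(1)]
    have XR: "X \<subseteq> R" using Suc.prems(3) adj_rs by (auto simp: X_def fresh_def)
    show ?thesis
    proof (cases found1)
      case True
      then have "lev' = lev1" "res = Some d" using Suc.prems(5) False 1 by auto
      then show ?thesis using lay(2) ex True XR Suc.prems(2) by auto
    next
      case False
      have res: "val (bfs r (Suc d) next1 adj mr lev1) = (lev', res)"
        using Suc.prems(5) False \<open>layer \<noteq> []\<close> 1 by auto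
      have reached: "\<forall>v\<in>R. lev1 v \<noteq> None \<longrightarrow> mr v \<noteq> None"
        using ex False Suc.prems(2) by auto
      have next1: "set next1 = {u \<in> L. ldist ml lev1 u = Some (Suc d)}"
        using ex(2) lay(3) by simp
      obtain u where u: "u \<in> L" "ldist ml lev u = Some d"
        using Suc.prems(3) \<open>layer \<noteq> []\<close> by (metis (mono_tags, lifting) empty_Collect_eq set_empty)
      have "{u \<in> L. \<forall>i<Suc d. ldist ml lev1 u \<noteq> Some i} \<subset> {u \<in> L. \<forall>i<d. ldist ml lev u \<noteq> Some i}"
      proof (rule psubsetI)
        show "{u \<in> L. \<forall>i<Suc d. ldist ml lev1 u \<noteq> Some i} \<subseteq> {u \<in> L. \<forall>i<d. ldist ml lev u \<noteq> Some i}"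
          using lay(1) by (intro Collect_mono) (metis less_SucI less_imp_le)
        show "{u \<in> L. \<forall>i<Suc d. ldist ml lev1 u \<noteq> Some i} \<noteq> {u \<in> L. \<forall>i<d. ldist ml lev u \<noteq> Some i}"
          using u lay(1)[OF u(1), of d] by auto
      qed
      then have "card {u \<in> L. \<forall>i<Suc d. ldist ml lev1 u \<noteq> Some i}
          < card {u \<in> L. \<forall>i<d. ldist ml lev u \<noteq> Some i}"
        by (intro psubset_card_mono) auto
      then have "card {u \<in> L. \<forall>i<Suc d. ldist ml lev1 u \<noteq> Some i} \<le> r"
        using Suc.prems(4) by simp
      from Suc.IH[OF lay(2) reached next1 this res] show ?thesis .
    qed
  qed
qed

text \<open>The potential is the weight of the current layer plus the unseen weight. Expanding a
  layer consumes the former and redistributes the latter by \<open>expand_weight\<close>.\<close>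

lemma steps_bfs:
  assumes m: "mates ml mr" and "set layer \<subseteq> L"
  shows "steps (bfs r d layer adj mr lev) \<le> (\<Sum>u\<leftarrow>layer. weight u) + unseen_weight mr lev + 1"
  using assms(2)
proof (induction r arbitrary: d layer lev)
  case (Suc r)
  show ?case
  proof (cases "layer = []")
    case False
    obtain lev1 next1 found1 where
      1: "val (expand d layer adj mr (lev, [], False)) = (lev1, next1, found1)"
      by (metis prod_cases3)
    have w: "(\<Sum>u\<leftarrow>next1. weight u) + unseen_weight mr lev1 = unseen_weight mr lev"
      using expand_weight[OF Suc.prems 1] by simp
    have "(\<Sum>u\<leftarrow>layer. length (adj u) + 2) + 2 \<le> (\<Sum>u\<leftarrow>layer. weight u)"
    proof (cases layer)
      case (Cons u us)
      have "(\<Sum>u\<leftarrow>us. length (adj u) + 2) \<le> (\<Sum>u\<leftarrow>us. weight u)"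
        by (rule sum_list_mono) (simp add: weight_def)
      then show ?thesis using Cons by (simp add: weight_def)
    qed (use False in simp)
    then have e: "steps (expand d layer adj mr (lev, [], False)) + 1 \<le> (\<Sum>u\<leftarrow>layer. weight u)"
      by (simp add: steps_expand)
    have "set (adj u) \<subseteq> R" if "u \<in> set layer" for u using that Suc.prems adj_rs by auto
    then have "set next1 \<subseteq> L"
      using expand[OF 1] mates_right(1)[OF m] by (fastforce simp: fresh_def)
    then show ?thesis
      using False 1 e w Suc.IH[of next1 "Suc d" lev1] by simp
  qed simp
qed simp

end

section \<open>Depth-first search\<close>

text \<open>Attaching \<open>u\<close> to the free vertex \<open>v\<close> leaves the former mate
  \<open>y\<close> of \<open>u\<close> free. This is one step of an augmentation performed from the
  far end: \<open>y\<close> is then attached to the preceding left vertex.\<close>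

lemma (in adjacency) mates_update:
  assumes m: "mates ml mr" and uv: "u \<in> L" "v \<in> set (adj u)" "mr v = None"
  shows "mates (ml(u := Some v))
    (case ml u of None \<Rightarrow> mr(v := Some u) | Some y \<Rightarrow> mr(v := Some u, y := None))"
proof -
  define mr' where
    "mr' = (case ml u of None \<Rightarrow> mr(v := Some u) | Some y \<Rightarrow> mr(v := Some u, y := None))"
  have ml_v: "ml x \<noteq> Some v" if "x \<in> L" for x
    using mates_left(3)[OF m that, of v] uv(3) by auto
  have mr'_v: "mr' v = Some u"
    using ml_v[OF uv(1)] by (auto simp: mr'_def split: option.split)
  have mr': "mr' y = (if ml u = Some y then None else mr y)" if "y \<noteq> v" for y
    using that by (auto simp: mr'_def split: option.split)
  show ?thesis
    unfolding mates_def mr'_def[symmetric]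
  proof (intro conjI ballI allI impI)
    fix x y assume x: "x \<in> L" "(ml(u := Some v)) x = Some y"
    show "y \<in> set (adj x)" using x uv mates_left(1)[OF m x(1)] by (auto split: if_splits)
    show "mr' y = Some x"
    proof (cases "x = u")
      case True
      then show ?thesis using x mr'_v by simp
    next
      case False
      then have "ml x = Some y" using x by simp
      then have "mr y = Some x" using mates_left(3)[OF m x(1)] by blast
      moreover have "y \<noteq> v" using ml_v x(1) \<open>ml x = Some y\<close> by blast
      moreover have "ml u \<noteq> Some y"
        using mates_left(3)[OF m uv(1), of y] \<open>mr y = Some x\<close> False by auto
      ultimately show ?thesis using mr' by simp
    qed
  next
    fix y x assume y: "y \<in> R" "mr' y = Some x"
    have "x \<in> L \<and> (ml(u := Some v)) x = Some y"
    proof (cases "y = v")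
      case True
      then show ?thesis using y mr'_v uv by simp
    next
      case False
      then have "mr y = Some x" "ml u \<noteq> Some y" using y mr' by (auto split: if_splits)
      then show ?thesis using mates_right[OF m y(1), of x] by auto
    qed
    then show "x \<in> L" "(ml(u := Some v)) x = Some y" by auto
  qed
qed

text \<open>The index 0 marks the state between the two searches of one phase. Free right vertices
  have been found on level \<open>D\<close>, and the layers 0 to \<open>D\<close> are complete,
  hence \<open>Suc D\<close>.\<close>

locale phase = adjacency +
  fixes ml0 mr0 lev0 :: "nat option arr" and D :: nat
  assumes mates0: "mates ml0 mr0" and layered0: "layered ml0 lev0 (Suc D)"
begin

abbreviation "ll \<equiv> ldist ml0 lev0"

lemma ll_mate:
  assumes "v \<in> R" "mr0 v = Some w"
  shows "w \<in> L" "ll w = map_option Suc (lev0 v)"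
  using mates_right[OF mates0 assms] by (auto simp: ldist_def)

text \<open>A right vertex \<open>v\<close> removed from the layered graph either lies on an augmenting path, and
  then its new mate is in the layer it was reached from, or it has kept its mate, from which no
  vertex of the next layer can be reached any more.\<close>

definition finished :: "nat option arr \<Rightarrow> nat option arr \<Rightarrow> nat \<Rightarrow> bool" where
  "finished lev mr v \<longleftrightarrow> (\<exists>w\<in>L. mr v = Some w \<and>
     (ll w = lev0 v \<or>
      ll w = map_option Suc (lev0 v) \<and> (\<forall>x\<in>set (adj w). lev0 x = ll w \<longrightarrow> lev x = None)))"

text \<open>A relation between an earlier and a later state of the same phase. It is reflexive and
  transitive, so the effects of nested and of consecutive searches compose.\<close>

definition visits :: "nat option arr \<Rightarrow> nat option arr \<Rightarrow> nat option arr \<Rightarrow> nat option arr \<Rightarrow> bool"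
  where "visits lev mr lev' mr' \<longleftrightarrow> (\<forall>v\<in>R. lev' v = lev v \<and> mr' v = mr v \<or>
     lev v \<noteq> None \<and> lev' v = None \<and> finished lev' mr' v)"

definition unvisited_intact :: "nat option arr \<Rightarrow> nat option arr \<Rightarrow> bool" where
  "unvisited_intact lev mr \<longleftrightarrow> (\<forall>v\<in>R. lev v = None \<or> lev v = lev0 v \<and> mr v = mr0 v)"

lemma visits_None:
  assumes "visits lev mr lev' mr'" "v \<in> R" "lev v = None"
  shows "lev' v = None" "mr' v = mr v"
  using assms by (auto simp: visits_def)

lemma visits_refl: "visits lev mr lev mr"
  by (simp add: visits_def)

lemma visits_intact: "visits lev mr lev' mr' \<Longrightarrow> unvisited_intact lev mr \<Longrightarrow> unvisited_intact lev' mr'"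
  unfolding visits_def unvisited_intact_def by metis

text \<open>\<open>finished\<close> only asks for vertices to be removed, and removal is
  permanent.\<close>

lemma finished_mono:
  assumes "finished lev mr v" "mr' v = mr v" "\<And>x. x \<in> R \<Longrightarrow> lev x = None \<Longrightarrow> lev' x = None"
  shows "finished lev' mr' v"
proof -
  obtain w where w: "w \<in> L" "mr v = Some w" "ll w = lev0 v \<or>
      ll w = map_option Suc (lev0 v) \<and> (\<forall>x\<in>set (adj w). lev0 x = ll w \<longrightarrow> lev x = None)"
    using assms(1) unfolding finished_def by blast
  have "set (adj w) \<subseteq> R" using adj_rs[OF w(1)] .
  then have "ll w = lev0 v \<or>
      ll w = map_option Suc (lev0 v) \<and> (\<forall>x\<in>set (adj w). lev0 x = ll w \<longrightarrow> lev' x = None)"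
    using w(3) assms(3) by blast
  then show ?thesis unfolding finished_def using w assms(2) by auto
qed

text \<open>Removed vertices are never touched again, so a vertex finished in the first stage keeps
  its mate throughout the second.\<close>

lemma visits_trans:
  assumes 1: "visits lev mr lev1 mr1" and 2: "visits lev1 mr1 lev2 mr2"
  shows "visits lev mr lev2 mr2"
  unfolding visits_def
proof
  fix v assume v: "v \<in> R"
  consider (same) "lev1 v = lev v" "mr1 v = mr v"
    | (new) "lev v \<noteq> None" "lev1 v = None" "finished lev1 mr1 v"
    using bspec[OF 1[unfolded visits_def] v] by auto
  then show "lev2 v = lev v \<and> mr2 v = mr v \<or> lev v \<noteq> None \<and> lev2 v = None \<and> finished lev2 mr2 v"
  proof cases
    case same
    then show ?thesis using bspec[OF 2[unfolded visits_def] v] by simp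
  next
    case new
    have "finished lev2 mr2 v"
      using new(3) visits_None(2)[OF 2 v new(2)] visits_None(1)[OF 2] by (rule finished_mono)
    then show ?thesis using new visits_None(1)[OF 2 v new(2)] by blast
  qed
qed

text \<open>Used when a search begun after the removal of \<open>v\<close> has returned:
  \<open>v\<close> may still receive a new mate, which is why \<open>mr''\<close> is free at
  \<open>v\<close>.\<close>

lemma visits_insert:
  assumes vis: "visits (lev(v := None)) mr lev' mr'" and v: "v \<in> R" "lev v \<noteq> None"
    and fin: "finished lev' mr'' v" and mr'': "\<And>x. x \<noteq> v \<Longrightarrow> mr'' x = mr' x"
  shows "visits lev mr lev' mr''"
  unfolding visits_def
proof
  fix x assume x: "x \<in> R"
  show "lev' x = lev x \<and> mr'' x = mr x \<or> lev x \<noteq> None \<and> lev' x = None \<and> finished lev' mr'' x"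
  proof (cases "x = v")
    case True
    then show ?thesis using visits_None(1)[OF vis v(1)] fin v by simp
  next
    case False
    then have "lev' x = lev x \<and> mr' x = mr x \<or> lev x \<noteq> None \<and> lev' x = None \<and> finished lev' mr' x"
      using bspec[OF vis[unfolded visits_def] x] by simp
    moreover have "finished lev' mr' x \<Longrightarrow> finished lev' mr'' x"
      using finished_mono[of lev' mr' x mr'' lev'] mr''[OF False] by simp
    ultimately show ?thesis using mr''[OF False] by auto
  qed
qed

text \<open>The budget for nested searches: the search at the mate \<open>w\<close> of
  \<open>v\<close> pays one step per entry of \<open>adj w\<close> and one for the end of the list,
  and \<open>v\<close> is removed just before. The mates are taken from \<open>mr0\<close> because
  unvisited vertices still have their original mate.\<close>

definition unvisited_weight :: "nat option arr \<Rightarrow> nat" where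
  "unvisited_weight lev =
     (\<Sum>v\<in>{v \<in> R. lev v \<noteq> None}. case mr0 v of None \<Rightarrow> 0 | Some w \<Rightarrow> length (adj w) + 1)"

lemma unvisited_weight_remove:
  assumes "v \<in> R" "lev v \<noteq> None"
  shows "unvisited_weight lev = unvisited_weight (lev(v := None)) +
    (case mr0 v of None \<Rightarrow> 0 | Some w \<Rightarrow> length (adj w) + 1)"
proof -
  have "{x \<in> R. (lev(v := None)) x \<noteq> None} = {v \<in> R. lev v \<noteq> None} - {v}" by auto
  then show ?thesis using assms by (simp add: unvisited_weight_def sum.remove)
qed

text \<open>When the search at \<open>u\<close> succeeds, the former mate of \<open>u\<close> still points to \<open>u\<close>; it gets its
  new mate from the caller.\<close>

definition dfs_post where
  "dfs_post d u vs lev ml mr ok lev' ml' mr' \<longleftrightarrow>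
     visits lev mr lev' mr' \<and>
     (\<forall>x\<in>L. ml x \<noteq> None \<longrightarrow> ml' x \<noteq> None) \<and>
     (\<forall>v\<in>R. mr v \<noteq> None \<longrightarrow> mr' v \<noteq> None) \<and>
     (\<forall>x\<in>L. x \<noteq> u \<longrightarrow> (\<forall>y. ml x = Some y \<longrightarrow> lev y = None) \<longrightarrow> ml' x = ml x) \<and>
     (if ok then ml' u \<noteq> None \<and>
        mates ml' (case ml u of None \<Rightarrow> mr' | Some y \<Rightarrow> mr'(y := None))
      else ml' = ml \<and> mr' = mr \<and> (\<forall>v\<in>set vs. lev0 v = Some d \<longrightarrow> lev' v = None))"

text \<open>The outer induction on \<open>r\<close> handles the nested search from a mate, the inner
  one on \<open>vs\<close> the remaining neighbours. As \<open>r + d = D\<close>, \<open>r\<close>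
  is 0 exactly in the last layer. The search has come to \<open>u\<close> through its mate, which is
  already removed; vertices with removed mates are left alone by nested searches, so the current
  path stays intact.\<close>

lemma dfs:
  assumes "u \<in> L" "ll u = Some d" "r + d = D" "set vs \<subseteq> set (adj u)"
    and "\<forall>y. ml u = Some y \<longrightarrow> lev y = None"
    and "mates ml mr" "unvisited_intact lev mr"
    and "val (dfs r d u vs adj (lev, ml, mr)) = (ok, lev', ml', mr')"
  shows "dfs_post d u vs lev ml mr ok lev' ml' mr' \<and>
    steps (dfs r d u vs adj (lev, ml, mr)) + unvisited_weight lev' \<le> length vs + 1 + unvisited_weight lev"
  using assms
proof (induction r arbitrary: d u vs lev ml mr ok lev' ml' mr' rule: less_induct)
  case (less r)
  note outer = less.IH
  note u = less.prems(1-3)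
  show ?case
    using less.prems(4-)
  proof (induction vs arbitrary: lev)
    case Nil
    then show ?case by (auto simp: dfs_post_def visits_refl)
  next
    case (Cons v vs)
    note prems = Cons.prems
    have v: "v \<in> set (adj u)" "v \<in> R" using prems(1) adj_rs u(1) by auto
    have vs: "set vs \<subseteq> set (adj u)" using prems(1) by auto
    have intact_upd: "unvisited_intact (lev(v := None)) mr"
      using prems(4) by (auto simp: unvisited_intact_def)
    \<comment> \<open>the search goes on with \<open>vs\<close>, after \<open>v\<close> has been found to lead nowhere\<close>
    have continue: "dfs_post d u (v # vs) lev ml mr ok lev' ml' mr' \<and>
        steps (dfs r d u vs adj (lev1, ml, mr)) + unvisited_weight lev' \<le> length vs + 1 + unvisited_weight lev1"
      if vis: "visits lev mr lev1 mr" and v1: "lev0 v = Some d \<longrightarrow> lev1 v = None"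
        and run: "val (dfs r d u vs adj (lev1, ml, mr)) = (ok, lev', ml', mr')" for lev1
    proof -
      have mate: "lev1 y = None" if "x \<in> L" "ml x = Some y" "lev y = None" for x y
        using that visits_None(1)[OF vis] mates_left(2)[OF prems(3)] by blast
      have "\<forall>y. ml u = Some y \<longrightarrow> lev1 y = None" using prems(2) mate u(1) by blast
      from Cons.IH[OF vs this prems(3) visits_intact[OF vis prems(4)] run]
      have post: "dfs_post d u vs lev1 ml mr ok lev' ml' mr'" and
        st: "steps (dfs r d u vs adj (lev1, ml, mr)) + unvisited_weight lev' \<le> length vs + 1 + unvisited_weight lev1"
        by auto
      have vis': "visits lev1 mr lev' mr'" using post by (simp add: dfs_post_def)
      have "visits lev mr lev' mr'" using vis vis' by (rule visits_trans)
      moreover have "lev0 v = Some d \<longrightarrow> lev' v = None"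
        using v1 visits_None(1)[OF vis' v(2)] by blast
      moreover have "\<forall>x\<in>L. x \<noteq> u \<longrightarrow> (\<forall>y. ml x = Some y \<longrightarrow> lev y = None) \<longrightarrow> ml' x = ml x"
        using post mate unfolding dfs_post_def by blast
      ultimately have "dfs_post d u (v # vs) lev ml mr ok lev' ml' mr'"
        using post unfolding dfs_post_def by (auto split: if_splits)
      then show ?thesis using st by blast
    qed
    show ?case
    proof (cases "lev v = Some d")
      case False
      then have run: "val (dfs r d u vs adj (lev, ml, mr)) = (ok, lev', ml', mr')"
        using prems(5) by simp
      have "lev0 v = Some d \<longrightarrow> lev v = None"
        using False prems(4) v(2) unfolding unvisited_intact_def by metis
      from continue[OF visits_refl this run] False show ?thesis by simp
    next
      case True
      then have lev0: "lev0 v = Some d" and mr0: "mr v = mr0 v"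
        using prems(4) v(2) by (auto simp: unvisited_intact_def)
      have lvN: "lev v \<noteq> None" using True by simp
      note weight = unvisited_weight_remove[of v lev, OF v(2) lvN]
      \<comment> \<open>The first alternative of \<open>finished\<close>: the new mate
        \<open>u\<close> is in the layer from which \<open>v\<close> is reached.\<close>
      have uv: "finished l (m(v := Some u)) v" for l m
        using u lev0 by (auto simp: finished_def)
      show ?thesis
      proof (cases "mr v")
        case None
        then have res: "ok" "lev' = lev(v := None)" "ml' = ml(u := Some v)" "mr' = mr(v := Some u)"
          using prems(5) True by auto
        have "visits lev mr lev' mr'"
          using visits_insert[of lev v mr lev' mr mr'] visits_refl v(2) lvN uv res(2,4) by simp
        moreover have "mates ml' (case ml u of None \<Rightarrow> mr' | Some y \<Rightarrow> mr'(y := None))"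
          unfolding res(3,4) using mates_update[OF prems(3) u(1) v(1) None] .
        ultimately have "dfs_post d u (v # vs) lev ml mr ok lev' ml' mr'"
          using res by (auto simp: dfs_post_def)
        moreover have "steps (dfs r d u (v # vs) adj (lev, ml, mr)) = 1"
          using True None by simp
        moreover have "unvisited_weight lev' \<le> unvisited_weight lev"
          unfolding res(2) weight by simp
        ultimately show ?thesis by linarith
      next
        case (Some w)
        have w: "w \<in> L" "ll w = Some (Suc d)"
          using ll_mate[OF v(2)] mr0 Some lev0 by auto
        have mlw: "ml w = Some v" using mates_right(2)[OF prems(3) v(2) Some] .
        \<comment> \<open>The mate of \<open>w\<close> is still unvisited, while that of
          \<open>u\<close> has been removed.\<close>
        have wu: "w \<noteq> u" using mlw prems(2) True by auto
        have weight': "unvisited_weight lev = unvisited_weight (lev(v := None)) + (length (adj w) + 1)"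
          using weight unfolding mr0[symmetric] Some by simp
        show ?thesis
        proof (cases r)
          case 0
          have "finished (lev(v := None)) mr v"
          proof -
            \<comment> \<open>Here \<open>d = D\<close>, and no level exceeds \<open>D\<close>; the
              second alternative of \<open>finished\<close> holds vacuously.\<close>
            have "lev0 x \<noteq> ll w" if "x \<in> set (adj w)" for x
              using layered_right(1)[OF layered0, of x "Suc d"] that adj_rs w 0 u(3) by auto
            then show ?thesis using Some w lev0 by (auto simp: finished_def)
          qed
          then have "visits lev mr (lev(v := None)) mr"
            using visits_insert[of lev v mr "lev(v := None)" mr mr] visits_refl v(2) lvN by simp
          moreover have "val (dfs r d u vs adj (lev(v := None), ml, mr)) = (ok, lev', ml', mr')"
            using prems(5) True Some 0 by simp
          ultimately show ?thesis
            using continue[of "lev(v := None)"] True Some 0 weight' by simp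
        next
          case (Suc r')
          obtain ok1 lev1 ml1 mr1 where
            run1: "val (dfs r' (Suc d) w (adj w) adj (lev(v := None), ml, mr)) = (ok1, lev1, ml1, mr1)"
            by (metis prod_cases4)
          have "\<forall>y. ml w = Some y \<longrightarrow> (lev(v := None)) y = None" using mlw by simp
          moreover have "r' < r" "r' + Suc d = D" using Suc u(3) by auto
          ultimately have nested: "dfs_post (Suc d) w (adj w) (lev(v := None)) ml mr ok1 lev1 ml1 mr1 \<and>
            steps (dfs r' (Suc d) w (adj w) adj (lev(v := None), ml, mr)) + unvisited_weight lev1
              \<le> length (adj w) + 1 + unvisited_weight (lev(v := None))"
            using outer[OF _ w _ subset_refl _ prems(3) intact_upd run1] by blast
          note post = nested[THEN conjunct1] and st = nested[THEN conjunct2]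
          have vis1: "visits (lev(v := None)) mr lev1 mr1" using post by (simp add: dfs_post_def)
          have lev1v: "lev1 v = None" using visits_None(1)[OF vis1 v(2)] by simp
          show ?thesis
          proof (cases ok1)
            case False
            then have same: "ml1 = ml" "mr1 = mr"
              and dead: "\<forall>x\<in>set (adj w). lev0 x = Some (Suc d) \<longrightarrow> lev1 x = None"
              using post by (auto simp: dfs_post_def)
            \<comment> \<open>The nested search failed, so every neighbour of \<open>w\<close> in
              the next layer has been removed.\<close>
            have "finished lev1 mr v"
              unfolding finished_def using w Some lev0 dead by auto
            then have vis: "visits lev mr lev1 mr"
              using visits_insert[OF vis1 v(2) lvN, of mr] same by simp
            have "val (dfs r d u vs adj (lev1, ml, mr)) = (ok, lev', ml', mr')"
              using prems(5) True Some Suc run1 False same by simp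
            from continue[OF vis _ this] lev1v show ?thesis
              using st weight' True Some Suc run1 False same by simp
          next
            case ok1: True
            have res: "ok" "lev' = lev1" "ml' = ml1(u := Some v)" "mr' = mr1(v := Some u)"
              using prems(5) True Some Suc run1 ok1 by auto
            have frame: "ml1 x = ml x" if "x \<in> L" "x \<noteq> w" "\<forall>y. ml x = Some y \<longrightarrow> lev y = None" for x
              using post that unfolding dfs_post_def by (metis fun_upd_apply)
            \<comment> \<open>The stale pointer after the nested success is the one of
              \<open>v\<close>, the former mate of \<open>w\<close>. Clearing it makes
              \<open>v\<close> free, so that \<open>mates_update\<close> can attach
              \<open>u\<close>.\<close>
            have "mates ml1 (mr1(v := None))"
              using post ok1 mlw by (simp add: dfs_post_def)
            then have "mates (ml1(u := Some v)) (case ml1 u of None \<Rightarrow> mr1(v := None, v := Some u)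
                | Some y \<Rightarrow> mr1(v := None, v := Some u, y := None))"
              by (rule mates_update[OF _ u(1) v(1)]) simp
            moreover have "ml1 u = ml u" using frame[OF u(1)] wu prems(2) by simp
            ultimately have "mates ml' (case ml u of None \<Rightarrow> mr' | Some y \<Rightarrow> mr'(y := None))"
              unfolding res(3,4) fun_upd_upd by metis
            moreover have "visits lev mr lev' mr'"
              using visits_insert[OF vis1 v(2) lvN, of mr'] uv res(2,4) by simp
            moreover have "\<forall>x\<in>L. x \<noteq> u \<longrightarrow> (\<forall>y. ml x = Some y \<longrightarrow> lev y = None) \<longrightarrow> ml' x = ml x"
              unfolding res(3) using frame mlw lvN by (metis fun_upd_other)
            ultimately have "dfs_post d u (v # vs) lev ml mr ok lev' ml' mr'"
              using post res by (auto simp: dfs_post_def)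
            moreover have "steps (dfs r d u (v # vs) adj (lev, ml, mr)) + unvisited_weight lev'
                \<le> length (v # vs) + 1 + unvisited_weight lev"
              using st weight' True Some Suc run1 ok1 res(2) by simp
            ultimately show ?thesis by blast
          qed
        qed
      qed
    qed
  qed
qed

text \<open>Matched vertices never become free, so a vertex free now was free at the start and lies
  in layer 0. Having no former mate, it leaves no stale pointer behind. A success enlarges the set
  of matched left vertices; a failure changes no mates and exhausts the level-0 neighbours of its
  root.\<close>

lemma augment:
  assumes "set us \<subseteq> L" "mates ml mr" "unvisited_intact lev mr"
    and "\<forall>u\<in>L. ml u = None \<longrightarrow> ml0 u = None"
    and "val (augment D us adj (lev, ml, mr)) = (lev', ml', mr')"
  shows "(visits lev mr lev' mr' \<and> mates ml' mr' \<and>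
    (\<forall>u\<in>L. ml u \<noteq> None \<longrightarrow> ml' u \<noteq> None) \<and> (\<forall>v\<in>R. mr v \<noteq> None \<longrightarrow> mr' v \<noteq> None) \<and>
    (\<forall>u\<in>set us. ml' u = None \<longrightarrow> (\<forall>v\<in>set (adj u). lev0 v = Some 0 \<longrightarrow> lev' v = None)) \<and>
    (ml' = ml \<and> mr' = mr \<or> matched ml \<subset> matched ml')) \<and>
    steps (augment D us adj (lev, ml, mr)) + unvisited_weight lev'
      \<le> (\<Sum>u\<leftarrow>us. length (adj u) + 2) + 1 + unvisited_weight lev"
  using assms
proof (induction us arbitrary: lev ml mr)
  case Nil
  then show ?case by (auto simp: visits_refl)
next
  case (Cons u us)
  note prems = Cons.prems
  have u: "u \<in> L" and us: "set us \<subseteq> L" using prems(1) by auto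
  show ?case
  proof (cases "ml u = None")
    case False
    then have run: "val (augment D us adj (lev, ml, mr)) = (lev', ml', mr')" using prems(5) by simp
    note IH = Cons.IH[OF us prems(2-4) run]
    then have "ml' u \<noteq> None" using u False by blast
    then show ?thesis using IH False by auto
  next
    case True
    obtain ok lev1 ml1 mr1 where
      run1: "val (dfs D 0 u (adj u) adj (lev, ml, mr)) = (ok, lev1, ml1, mr1)"
      by (metis prod_cases4)
    have ll: "ll u = Some 0" using prems(4) u True by (simp add: ldist_def)
    have "\<forall>y. ml u = Some y \<longrightarrow> lev y = None" using True by simp
    from dfs[OF u ll _ subset_refl this prems(2,3) run1]
    have post: "dfs_post 0 u (adj u) lev ml mr ok lev1 ml1 mr1"
      and st: "steps (dfs D 0 u (adj u) adj (lev, ml, mr)) + unvisited_weight lev1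
        \<le> length (adj u) + 1 + unvisited_weight lev"
      by auto
    have vis1: "visits lev mr lev1 mr1" and grow1: "\<forall>x\<in>L. ml x \<noteq> None \<longrightarrow> ml1 x \<noteq> None"
      "\<forall>v\<in>R. mr v \<noteq> None \<longrightarrow> mr1 v \<noteq> None"
      using post unfolding dfs_post_def by blast+
    have m1: "mates ml1 mr1" using post True prems(2) by (auto simp: dfs_post_def split: if_splits)
    have fr1: "\<forall>u\<in>L. ml1 u = None \<longrightarrow> ml0 u = None" using prems(4) grow1(1) by blast
    have run2: "val (augment D us adj (lev1, ml1, mr1)) = (lev', ml', mr')"
      using prems(5) True run1 by simp
    note IH = Cons.IH[OF us m1 visits_intact[OF vis1 prems(3)] fr1 run2]
    have vis2: "visits lev1 mr1 lev' mr'" and grow2: "\<forall>x\<in>L. ml1 x \<noteq> None \<longrightarrow> ml' x \<noteq> None"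
      "\<forall>v\<in>R. mr1 v \<noteq> None \<longrightarrow> mr' v \<noteq> None"
      and prog2: "ml' = ml1 \<and> mr' = mr1 \<or> matched ml1 \<subset> matched ml'"
      using IH by blast+
    have free: "lev' v = None" if "ml' u = None" "v \<in> set (adj u)" "lev0 v = Some 0" for v
    proof -
      have "\<not> ok" using post grow2(1) u that(1) by (auto simp: dfs_post_def)
      then have "lev1 v = None" using post that by (simp add: dfs_post_def)
      moreover have "v \<in> R" using that(2) adj_rs u by blast
      ultimately show ?thesis using visits_None(1)[OF vis2] by blast
    qed
    have prog: "ml' = ml \<and> mr' = mr \<or> matched ml \<subset> matched ml'"
    proof (cases ok)
      case False
      then have "ml1 = ml" "mr1 = mr" using post by (auto simp: dfs_post_def)
      then show ?thesis using prog2 by simp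
    next
      case ok: True
      then have "ml1 u \<noteq> None" using post by (auto simp: dfs_post_def)
      then have "u \<in> matched ml1" "u \<notin> matched ml" using u True by (auto simp: matched_def)
      moreover have "matched ml \<subseteq> matched ml1" using grow1(1) by (auto simp: matched_def)
      moreover have "matched ml1 \<subseteq> matched ml'" using prog2 by auto
      ultimately show ?thesis by blast
    qed
    have "steps (augment D (u # us) adj (lev, ml, mr)) + unvisited_weight lev'
        \<le> (\<Sum>u\<leftarrow>u # us. length (adj u) + 2) + 1 + unvisited_weight lev"
      using IH[THEN conjunct2] st True run1 by simp
    moreover have "visits lev mr lev' mr'" using vis1 vis2 by (rule visits_trans)
    moreover have "\<forall>u\<in>L. ml u \<noteq> None \<longrightarrow> ml' u \<noteq> None" "\<forall>v\<in>R. mr v \<noteq> None \<longrightarrow> mr' v \<noteq> None"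
      using grow1 grow2 by blast+
    moreover have "\<forall>u\<in>set (u # us). ml' u = None \<longrightarrow> (\<forall>v\<in>set (adj u). lev0 v = Some 0 \<longrightarrow> lev' v = None)"
      using free IH by (metis set_ConsD)
    ultimately show ?thesis using prog IH by blast
  qed
qed

text \<open>A vertex left alone keeps its old mate, one layer further; a removed one is
  \<open>finished\<close>, which describes its mate.\<close>

lemma new_mate:
  assumes vis: "visits lev0 mr0 lev mr" and v: "v \<in> R" "mr v = Some w" "lev0 v = Some i"
  shows "ll w = Some i \<or> ll w = Some (Suc i) \<and>
    (lev v = None \<longrightarrow> (\<forall>x\<in>set (adj w). lev0 x = Some (Suc i) \<longrightarrow> lev x = None))"
proof -
  from vis v(1) consider "lev v = lev0 v" "mr v = mr0 v" | "finished lev mr v"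
    unfolding visits_def by blast
  then show ?thesis
  proof cases
    case 1
    then show ?thesis using ll_mate(2)[OF v(1), of w] v by simp
  next
    case 2
    then show ?thesis using v by (auto simp: finished_def)
  qed
qed

text \<open>The layers only move away from the free vertices, and a vertex that keeps its layer has been
  visited in the previous phase.\<close>

lemma levels_increase:
  assumes free0: "\<forall>v\<in>R. mr0 v = None \<longrightarrow> lev0 v = None \<or> lev0 v = Some D"
    and vis: "visits lev0 mr0 lev mr" and m: "mates ml mr"
    and grow: "\<forall>u\<in>L. ml0 u \<noteq> None \<longrightarrow> ml u \<noteq> None" "\<forall>v\<in>R. mr0 v \<noteq> None \<longrightarrow> mr v \<noteq> None"
    and blocked: "\<forall>u\<in>L. ml u = None \<longrightarrow> (\<forall>v\<in>set (adj u). lev0 v = Some 0 \<longrightarrow> lev v = None)"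
    and lay: "layered ml lev' (Suc D')" and free: "v \<in> R" "mr v = None" "lev' v = Some D'"
  shows "D < D'"
proof (rule ccontr)
  assume "\<not> D < D'"
  then have D': "D' \<le> D" by simp
  have levels: "\<forall>v\<in>R. lev' v = Some j \<longrightarrow> (\<exists>i\<le>j. lev0 v = Some i) \<and> (lev0 v = Some j \<longrightarrow> lev v = None)"
    if "j \<le> D" for j
    using that
  proof (induction j)
    case 0
    show ?case
    proof (intro ballI impI)
      fix v assume "v \<in> R" "lev' v = Some 0"
      with layered_right(2)[OF lay] obtain u where
        u: "u \<in> L" "v \<in> set (adj u)" "ldist ml lev' u = Some 0" by blast
      have mlu: "ml u = None" using u(3) by (auto simp: ldist_def split: option.splits)
      then have "ml0 u = None" using grow(1) u(1) by blast
      then have "ll u = Some 0" by (simp add: ldist_def)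
      then have "\<exists>i\<le>0. lev0 v = Some i" using layered_left[OF layered0 u(1) _ _ u(2)] by blast
      then show "(\<exists>i\<le>0. lev0 v = Some i) \<and> (lev0 v = Some 0 \<longrightarrow> lev v = None)"
        using blocked u mlu by blast
    qed
  next
    case (Suc j)
    then have IH: "\<forall>v\<in>R. lev' v = Some j \<longrightarrow> (\<exists>i\<le>j. lev0 v = Some i) \<and> (lev0 v = Some j \<longrightarrow> lev v = None)"
      by simp
    show ?case
    proof (intro ballI impI)
      fix v assume "v \<in> R" "lev' v = Some (Suc j)"
      with layered_right(2)[OF lay] obtain u where
        u: "u \<in> L" "v \<in> set (adj u)" "ldist ml lev' u = Some (Suc j)" by blast
      obtain y where y: "ml u = Some y" "lev' y = Some j"
        using u(3) by (auto simp: ldist_def split: option.splits)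
      have yR: "y \<in> R" "mr y = Some u" using mates_left[OF m u(1) y(1)] by auto
      obtain i where i: "i \<le> j" "lev0 y = Some i" using IH y(2) yR(1) by blast
      have seen: "i = j \<Longrightarrow> lev y = None" using IH y(2) yR(1) i(2) by blast
      note mate = new_mate[OF vis yR i(2)]
      obtain t where t: "ll u = Some t" "t \<le> Suc i" using mate by auto
      have "t < Suc D" using t(2) i(1) Suc.prems by simp
      then obtain i' where i': "lev0 v = Some i'" "i' \<le> t"
        using layered_left[OF layered0 u(1) t(1) _ u(2)] by blast
      \<comment> \<open>Equality forces \<open>y\<close> to have kept its level and \<open>u\<close>
        to be one layer further. So \<open>y\<close> was removed as a dead end, and all neighbours
        of \<open>u\<close> on the next level, including \<open>v\<close>, were removed with
        it.\<close>
      have "lev v = None" if "lev0 v = Some (Suc j)"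
      proof -
        have eq: "i = j" "t = Suc i" using that i' t(2) i(1) by auto
        then show ?thesis using mate t(1) seen u(2) that by auto
      qed
      then show "(\<exists>i\<le>Suc j. lev0 v = Some i) \<and> (lev0 v = Some (Suc j) \<longrightarrow> lev v = None)"
        using i' t(2) i(1) by auto
    qed
  qed
  \<comment> \<open>A vertex free after the phase was free before it, hence of old level
    \<open>D\<close>. Then \<open>D' = D\<close>, so it was removed, but removed vertices are
    matched.\<close>
  have mr0: "mr0 v = None" using grow(2) free by blast
  obtain i where i: "i \<le> D'" "lev0 v = Some i" using levels[OF D'] free by blast
  then have "i = D" using free0 free(1) mr0 by auto
  then have "lev v = None" using levels[OF D'] free i D' by auto
  then have "finished lev mr v" using vis free(1) i(2) unfolding visits_def by auto
  then show False using free(2) by (auto simp: finished_def)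
qed

end

section \<open>The number of phases\<close>

context adjacency begin

text \<open>For each \<open>j < d\<close>, level \<open>j\<close> contains at least as many right
  vertices as there are missing edges, by \<open>cover_bound\<close>; the \<open>d\<close> levels
  are disjoint.\<close>

lemma layer_bound:
  assumes m: "mates ml mr" and lay: "layered ml lev (Suc d)"
    and free: "\<forall>v\<in>R. mr v = None \<longrightarrow> lev v = None \<or> lev v = Some d" and N: "pair_matching N"
  shows "d * (card N - card (matched ml)) \<le> card R"
proof -
  have "card N - card (matched ml) \<le> card {v \<in> R. lev v = Some j}" if j: "j < d" for j
  proof -
    let ?Y = "{v \<in> R. \<exists>i<j. lev v = Some i}" and ?Z = "{v \<in> R. \<exists>i\<le>j. lev v = Some i}"
    have "card N + card ?Y \<le> card (matched ml) + card ?Z"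
    proof (rule cover_bound[OF m _ _ _ _ N])
      fix v assume "v \<in> ?Y"
      then show "mr v \<noteq> None" using free j by auto
    next
      fix u v assume u: "u \<in> L" "\<forall>y. ml u = Some y \<longrightarrow> y \<in> ?Y" and v: "v \<in> set (adj u)"
      obtain i where i: "ldist ml lev u = Some i" "i \<le> j"
        using u(2) by (cases "ml u") (auto simp: ldist_def)
      then obtain i' where "lev v = Some i'" "i' \<le> i"
        using layered_left[OF lay u(1) i(1) _ v] j by auto
      then show "v \<in> ?Z" using i(2) v adj_rs u(1) by auto
    qed auto
    moreover have "?Z = ?Y \<union> {v \<in> R. lev v = Some j}" by (auto simp: le_less)
    moreover have "card (?Y \<union> {v \<in> R. lev v = Some j}) = card ?Y + card {v \<in> R. lev v = Some j}"
      by (intro card_Un_disjoint) auto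
    ultimately show ?thesis by simp
  qed
  then have "(\<Sum>j<d. card N - card (matched ml)) \<le> (\<Sum>j<d. card {v \<in> R. lev v = Some j})"
    by (intro sum_mono) simp
  also have "\<dots> = card (\<Union>j\<in>{..<d}. {v \<in> R. lev v = Some j})"
    by (rule card_UN_disjoint[symmetric]) auto
  also have "\<dots> \<le> card R" by (intro card_mono) auto
  finally show ?thesis by simp
qed

lemma pair_matching_mates:
  assumes m: "mates ml mr"
  shows "pair_matching {(u, v). u \<in> L \<and> ml u = Some v}"
    and "card {(u, v). u \<in> L \<and> ml u = Some v} = card (matched ml)"
proof -
  let ?M = "{(u, v). u \<in> L \<and> ml u = Some v}"
  have inj: "inj_on fst ?M" by (auto simp: inj_on_def)
  moreover have "inj_on snd ?M"
  proof (rule inj_onI)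
    fix e f assume "e \<in> ?M" "f \<in> ?M" "snd e = snd f"
    then obtain u u' v where "e = (u, v)" "f = (u', v)" "u \<in> L" "u' \<in> L" "ml u = Some v" "ml u' = Some v"
      by auto
    then show "e = f" using mates_left(3)[OF m, of u v] mates_left(3)[OF m, of u' v] by simp
  qed
  ultimately show "pair_matching ?M"
    using mates_left(1)[OF m] by (auto simp: pair_matching_def)
  have "fst ` ?M = matched ml" by (force simp: matched_def)
  then show "card ?M = card (matched ml)" using card_image[OF inj] by simp
qed

lemma sum_matched_le: "(\<Sum>u\<in>matched ml. f u :: nat) \<le> (\<Sum>u\<leftarrow>ls. f u)"
proof -
  have "(\<Sum>u\<in>matched ml. f u) \<le> (\<Sum>u\<in>L. f u)" by (intro sum_mono2) (auto simp: matched_def)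
  then show ?thesis using distinct_ls by (simp add: sum_list_distinct_conv_sum_set)
qed

section \<open>Cost of one phase and of all phases\<close>

definition edge_count :: nat where
  "edge_count = (\<Sum>u\<leftarrow>ls. length (adj u))"

lemma edge_count_add: "(\<Sum>u\<leftarrow>ls. length (adj u) + c) = edge_count + c * length ls"
  by (simp add: edge_count_def sum_list_addf sum_list_triv)

text \<open>Free left vertices are charged as the initial layer and matched ones through their
  mates, so each left vertex is charged once.\<close>

lemma steps_bfs_initial:
  assumes m: "mates ml mr" and lev: "\<forall>v\<in>R. lev v = None"
  shows "steps (bfs n d (filter (\<lambda>u. ml u = None) ls) adj mr lev) \<le> edge_count + 4 * length ls + 1"
proof -
  have "unseen_weight mr lev = (\<Sum>v\<in>R. case mr v of None \<Rightarrow> 0 | Some w \<Rightarrow> weight w)"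
    unfolding unseen_weight_def using lev by (intro sum.cong) (auto simp: fresh_def)
  also have "\<dots> = (\<Sum>u\<in>matched ml. weight u)" by (rule sum_mates[OF m])
  also have "(\<Sum>u\<leftarrow>filter (\<lambda>u. ml u = None) ls. weight u) + \<dots> = (\<Sum>u\<in>L. weight u)"
  proof -
    have "(\<Sum>u\<leftarrow>filter (\<lambda>u. ml u = None) ls. weight u) = (\<Sum>u\<in>{u \<in> L. ml u = None}. weight u)"
      using distinct_ls by (simp add: sum_list_distinct_conv_sum_set)
    moreover have "L = {u \<in> L. ml u = None} \<union> matched ml" by (auto simp: matched_def)
    moreover have "(\<Sum>u\<in>{u \<in> L. ml u = None} \<union> matched ml. weight u)
        = (\<Sum>u\<in>{u \<in> L. ml u = None}. weight u) + (\<Sum>u\<in>matched ml. weight u)"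
      by (intro sum.union_disjoint) (auto simp: matched_def)
    ultimately show ?thesis by simp
  qed
  also have "\<dots> = (\<Sum>u\<leftarrow>ls. weight u)"
    using distinct_ls by (simp add: sum_list_distinct_conv_sum_set)
  also have "\<dots> = edge_count + 4 * length ls" by (simp add: weight_def edge_count_add)
  finally show ?thesis
    using steps_bfs[OF m, of "filter (\<lambda>u. ml u = None) ls" n d lev] by auto
qed

text \<open>Breadth-first search, the searches at the free left vertices and the nested searches
  account for one \<open>edge_count\<close> each; the other terms include setting up
  \<open>lev\<close> and the initial layer.\<close>

definition phase_cost :: nat where
  "phase_cost = 3 * edge_count + 8 * length ls + length rs + 6"

text \<open>\<open>D\<close> is a lower bound on the level at which any further search can succeed.
  The potential is \<open>s - D\<close> plus the number of missing edges capped at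
  \<open>n div s\<close>. A phase with \<open>d < s\<close> lowers the first summand; otherwise at
  most \<open>n div s\<close> edges are missing and the second one drops.\<close>

lemma phases:
  assumes max: "pair_matching N" "\<And>N'. pair_matching N' \<Longrightarrow> card N' \<le> card N"
    and n: "length ls \<le> n" "length rs \<le> n" and s: "0 < s"
    and "mates ml mr"
    and "\<And>lev d v. layered ml lev (Suc d) \<Longrightarrow> v \<in> R \<Longrightarrow> mr v = None \<Longrightarrow> lev v = Some d \<Longrightarrow> D \<le> d"
    and "card N - card (matched ml) < r"
    and "val (phases r n ls rs adj ml mr) = (lev', ml', mr')"
  shows "mates ml' mr' \<and>
    (\<exists>d. layered ml' lev' d \<and> {u \<in> L. ldist ml' lev' u = Some d} = {}) \<and>
    (\<forall>v\<in>R. lev' v \<noteq> None \<longrightarrow> mr' v \<noteq> None) \<and>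
    steps (phases r n ls rs adj ml mr)
      \<le> phase_cost * ((s - D) + min (card N - card (matched ml)) (n div s) + 1)"
  using assms(6-)
proof (induction r arbitrary: ml mr D)
  case (Suc r)
  note m = Suc.prems(1)
  define lev where "lev = val (new_array rs (None :: nat option))"
  have lev: "\<forall>v\<in>R. lev v = None" by (simp add: lev_def val_new_array)
  define layer where "layer = filter (\<lambda>u. ml u = None) ls"
  obtain lev0 res where run: "val (bfs n 0 layer adj mr lev) = (lev0, res)" by fastforce
  have "layered ml lev 0" using lev by (simp add: layered_def)
  moreover have "\<forall>v\<in>R. lev v \<noteq> None \<longrightarrow> mr v \<noteq> None" using lev by simp
  moreover have "set layer = {u \<in> L. ldist ml lev u = Some 0}"
    by (auto simp: layer_def ldist_def split: option.splits)
  moreover have "card {u \<in> L. \<forall>i<0. ldist ml lev u \<noteq> Some i} \<le> n"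
    using n(1) distinct_ls by (simp add: distinct_card)
  ultimately have bfs: "case res of
      None \<Rightarrow> (\<exists>d'. layered ml lev0 d' \<and> {u \<in> L. ldist ml lev0 u = Some d'} = {}) \<and>
        (\<forall>v\<in>R. lev0 v \<noteq> None \<longrightarrow> mr v \<noteq> None)
    | Some d' \<Rightarrow> layered ml lev0 (Suc d') \<and>
        (\<forall>v\<in>R. mr v = None \<longrightarrow> lev0 v = None \<or> lev0 v = Some d') \<and>
        (\<exists>v\<in>R. mr v = None \<and> lev0 v = Some d')"
    using bfs[OF m _ _ _ _ run] by blast
  have st: "steps (bfs n 0 layer adj mr lev) \<le> edge_count + 4 * length ls + 1"
    using steps_bfs_initial[OF m lev] by (simp add: layer_def)
  show ?case
  proof (cases res)
    case None
    then have res: "lev' = lev0" "ml' = ml" "mr' = mr"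
      using Suc.prems(4) run by (auto simp: lev_def layer_def)
    have "steps (phases (Suc r) n ls rs adj ml mr) \<le> phase_cost"
      using st None run by (simp add: lev_def layer_def phase_cost_def)
    also have "\<dots> \<le> phase_cost * ((s - D) + min (card N - card (matched ml)) (n div s) + 1)" by simp
    finally show ?thesis using res bfs None m by auto
  next
    case (Some d)
    then have lay: "layered ml lev0 (Suc d)"
      and free: "\<forall>v\<in>R. mr v = None \<longrightarrow> lev0 v = None \<or> lev0 v = Some d"
      and ex: "\<exists>v\<in>R. mr v = None \<and> lev0 v = Some d"
      using bfs by auto
    interpret phase ls rs adj ml mr lev0 d by unfold_locales (fact m, fact lay)
    obtain lev1 ml1 mr1 where aug: "val (augment d ls adj (lev0, ml, mr)) = (lev1, ml1, mr1)"
      by (metis prod_cases3)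
    have intact: "unvisited_intact lev0 mr" by (simp add: unvisited_intact_def)
    have "\<forall>u\<in>L. ml u = None \<longrightarrow> ml u = None" by simp
    note aug' = augment[OF subset_refl m intact this aug, unfolded edge_count_add]
    have vis: "visits lev0 mr lev1 mr1" and m1: "mates ml1 mr1"
      and grow: "\<forall>u\<in>L. ml u \<noteq> None \<longrightarrow> ml1 u \<noteq> None" "\<forall>v\<in>R. mr v \<noteq> None \<longrightarrow> mr1 v \<noteq> None"
      and blocked: "\<forall>u\<in>L. ml1 u = None \<longrightarrow> (\<forall>v\<in>set (adj u). lev0 v = Some 0 \<longrightarrow> lev1 v = None)"
      and prog: "ml1 = ml \<and> mr1 = mr \<or> matched ml \<subset> matched ml1"
      and st_aug: "steps (augment d ls adj (lev0, ml, mr)) + unvisited_weight lev1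
        \<le> edge_count + 2 * length ls + 1 + unvisited_weight lev0"
      using aug' by blast+
    note increase = levels_increase[OF free vis m1 grow blocked]
    \<comment> \<open>With an unchanged matching, \<open>lev0\<close> would still be a layering with
      a free right vertex on level \<open>d\<close>, contradicting the strict increase.\<close>
    have "matched ml \<subset> matched ml1"
    proof (rule ccontr)
      assume "\<not> matched ml \<subset> matched ml1"
      then have "ml1 = ml" "mr1 = mr" using prog by auto
      then show False using increase[of lev0 d] lay ex by auto
    qed
    then have card1: "card (matched ml) < card (matched ml1)"
      by (intro psubset_card_mono) (auto simp: matched_def)
    have "card (matched ml1) \<le> card N"
      using max(2)[OF pair_matching_mates(1)[OF m1]] pair_matching_mates(2)[OF m1] by simp
    then have gap: "card N - card (matched ml1) < card N - card (matched ml)" using card1 by simp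
    have run1: "val (phases r n ls rs adj ml1 mr1) = (lev', ml', mr')"
      using Suc.prems(4) run Some aug by (simp add: lev_def layer_def)
    have D: "D \<le> d" using Suc.prems(2) lay ex by blast
    have "card N - card (matched ml1) < r" using gap Suc.prems(3) by simp
    moreover have "Suc d \<le> d'" if "layered ml1 lev (Suc d')" "v \<in> R" "mr1 v = None" "lev v = Some d'"
      for lev d' v using increase[OF that] by simp
    ultimately have IH: "mates ml' mr' \<and>
        (\<exists>d. layered ml' lev' d \<and> {u \<in> L. ldist ml' lev' u = Some d} = {}) \<and>
        (\<forall>v\<in>R. lev' v \<noteq> None \<longrightarrow> mr' v \<noteq> None) \<and>
        steps (phases r n ls rs adj ml1 mr1)
          \<le> phase_cost * ((s - Suc d) + min (card N - card (matched ml1)) (n div s) + 1)"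
      using Suc.IH[OF m1 _ _ run1, of "Suc d"] by blast
    define a b where "a = (s - Suc d) + min (card N - card (matched ml1)) (n div s)"
      and "b = (s - D) + min (card N - card (matched ml)) (n div s)"
    have "a < b"
    proof (cases "d < s")
      case True
      then show ?thesis using D gap unfolding a_def b_def by linarith
    next
      case False
      have "s * (card N - card (matched ml)) \<le> d * (card N - card (matched ml))"
        using False by simp
      also have "\<dots> \<le> n"
        using layer_bound[OF m lay free max(1)] n(2) distinct_rs by (simp add: distinct_card)
      finally have "card N - card (matched ml) \<le> n div s"
        using s by (simp add: less_eq_div_iff_mult_less_eq mult.commute)
      then show ?thesis using gap False by (simp add: a_def b_def)
    qed
    \<comment> \<open>The unit by which the potential drops pays for the current phase.\<close>
    then have "phase_cost * (Suc a + 1) \<le> phase_cost * (b + 1)" by (intro mult_le_mono2) simp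
    moreover have "steps (phases (Suc r) n ls rs adj ml mr)
        \<le> phase_cost + steps (phases r n ls rs adj ml1 mr1)"
    proof -
      have "unvisited_weight lev0 \<le> (\<Sum>v\<in>R. case mr v of None \<Rightarrow> 0 | Some w \<Rightarrow> length (adj w) + 1)"
        unfolding unvisited_weight_def by (intro sum_mono2) auto
      also have "\<dots> = (\<Sum>u\<in>matched ml. length (adj u) + 1)" by (rule sum_mates[OF m])
      also have "\<dots> \<le> edge_count + length ls"
        using sum_matched_le[of "\<lambda>u. length (adj u) + 1" ml] edge_count_add[of 1] by simp
      finally show ?thesis
        using st st_aug Some run aug by (simp add: lev_def layer_def phase_cost_def)
    qed
    moreover have "steps (phases r n ls rs adj ml1 mr1) \<le> phase_cost * (a + 1)"
      using IH by (simp add: a_def)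
    ultimately have "steps (phases (Suc r) n ls rs adj ml mr) \<le> phase_cost * (b + 1)" by simp
    then show ?thesis using IH unfolding b_def by blast
  qed
qed simp

lemma card_pair_matching:
  assumes "pair_matching N"
  shows "card N \<le> length ls" "card N \<le> length rs"
proof -
  have "fst ` N \<subseteq> L" "inj_on fst N" "snd ` N \<subseteq> R" "inj_on snd N"
    using assms adj_rs by (fastforce simp: pair_matching_def)+
  then have "card N \<le> card L" "card N \<le> card R" by (auto intro: card_inj_on_le)
  then show "card N \<le> length ls" "card N \<le> length rs"
    using distinct_ls distinct_rs by (simp_all add: distinct_card)
qed

end

section \<open>Hopcroft--Karp on edge lists\<close>

lemma maximum_exists:
  assumes "P X" and "\<And>Y. P Y \<Longrightarrow> card Y \<le> (b::nat)"
  obtains M where "maximum P M"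
proof -
  have "\<exists>x. P x \<and> (\<forall>y. P y \<longrightarrow> card y \<le> card x)"
    using ex_has_greatest_nat[of P X card "Suc b"] assms by (auto simp: le_imp_less_Suc)
  then show thesis using that by (auto simp: maximum_def)
qed

lemma sum_length_filter_fst:
  assumes "finite X" "fst ` set es \<subseteq> X"
  shows "(\<Sum>u\<in>X. length (filter (\<lambda>e. fst e = u) es)) = length es"
  using assms(2)
proof (induction es)
  case (Cons e es)
  have "(\<Sum>u\<in>X. length (filter (\<lambda>e. fst e = u) (e # es)))
      = (\<Sum>u\<in>X. (if fst e = u then 1 else 0) + length (filter (\<lambda>e. fst e = u) es))"
    by (intro sum.cong) auto
  also have "\<dots> = 1 + (\<Sum>u\<in>X. length (filter (\<lambda>e. fst e = u) es))"
    using Cons.prems assms(1) by (simp add: sum.distrib)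
  finally show ?case using Cons by simp
qed simp

text \<open>The last, unsuccessful search yields a vertex cover as large as the matching: the left
  vertices whose mate was not reached and the right vertices that were. The threshold
  \<open>s\<close> stays a parameter until it is balanced against \<open>n div s\<close>.\<close>

lemma hopcroft_karp_pairs:
  assumes dist: "distinct ls" "distinct rs" and es: "set es \<subseteq> set ls \<times> set rs"
    and n: "length ls + length rs \<le> n" and s: "0 < s"
    and run: "val (hopcroft_karp n ls rs es) = (lev, ml, mr)"
  defines "M \<equiv> {(u, v). u \<in> set ls \<and> ml u = Some v}"
  shows "M \<subseteq> set es" "inj_on fst M" "inj_on snd M"
    and "\<And>u v. (u, v) \<in> set es \<Longrightarrow> (\<exists>y. ml u = Some y \<and> lev y = None) \<or> lev v \<noteq> None"
    and "card {u \<in> set ls. \<exists>v. ml u = Some v \<and> lev v = None} + card {v \<in> set rs. lev v \<noteq> None} = card M"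
    and "steps (hopcroft_karp n ls rs es)
      \<le> (4 * length es + 10 * length ls + 2 * length rs + 14) * (s + n div s + 1)"
proof -
  have *: "(M \<subseteq> set es \<and> inj_on fst M \<and> inj_on snd M) \<and>
    (\<forall>(u, v)\<in>set es. (\<exists>y. ml u = Some y \<and> lev y = None) \<or> lev v \<noteq> None) \<and>
    card {u \<in> set ls. \<exists>v. ml u = Some v \<and> lev v = None} + card {v \<in> set rs. lev v \<noteq> None} = card M \<and>
    steps (hopcroft_karp n ls rs es)
      \<le> (4 * length es + 10 * length ls + 2 * length rs + 14) * (s + n div s + 1)"
  \<comment> \<open>For \<open>n = 0\<close> no phase is run and the levels are unspecified, but the
    graph is empty.\<close>
  proof (cases "n = 0")
    case True
    then have "ls = []" "rs = []" "es = []" using n es by auto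
    then show ?thesis using True s by (simp add: M_def hopcroft_karp_def)
  next
    case False
    define adj where "adj = val (build_adj es (val (new_array ls [])))"
    have adj: "set (adj u) = {v. (u, v) \<in> set es}"
      "length (adj u) = length (filter (\<lambda>e. fst e = u) es)" if "u \<in> set ls" for u
      using that by (simp_all add: adj_def set_build_adj length_build_adj val_new_array)
    interpret adjacency ls rs adj
      using dist es adj(1) by unfold_locales auto
    define ml1 where "ml1 = val (new_array ls (None :: nat option))"
    define mr1 where "mr1 = val (new_array rs (None :: nat option))"
    have ml1: "ml1 u = None" if "u \<in> L" for u using that by (simp add: ml1_def val_new_array)
    have mr1: "mr1 v = None" if "v \<in> R" for v using that by (simp add: mr1_def val_new_array)
    have m1: "mates ml1 mr1" using ml1 mr1 by (auto simp: mates_def)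
    obtain N where "maximum pair_matching N"
      using maximum_exists[of pair_matching "{}" "length ls"] card_pair_matching(1)
      by (auto simp: pair_matching_def)
    then have N: "pair_matching N" "\<And>N'. pair_matching N' \<Longrightarrow> card N' \<le> card N"
      by (auto simp: maximum_def)
    \<comment> \<open>\<open>card N\<close> is at most each of \<open>length ls\<close> and
      \<open>length rs\<close>, hence at most half of \<open>n\<close>.\<close>
    have fuel: "card N - card (matched ml1) < n"
      using card_pair_matching[OF N(1)] n False by linarith
    have run': "val (phases n n ls rs adj ml1 mr1) = (lev, ml, mr)"
      using run by (simp add: hopcroft_karp_def adj_def ml1_def mr1_def)
    have "length ls \<le> n" "length rs \<le> n" using n by auto
    note ph = phases[OF N this s m1 _ fuel run', of 0, simplified]
    then have m: "mates ml mr" and reached: "\<forall>v\<in>R. lev v \<noteq> None \<longrightarrow> mr v \<noteq> None" by auto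
    obtain d where lay: "layered ml lev d" and no: "{u \<in> L. ldist ml lev u = Some d} = {}"
      using ph by auto
    note M = pair_matching_mates[OF m, folded M_def]
    have "M \<subseteq> set es" "inj_on fst M" "inj_on snd M"
      using M(1) adj(1) by (auto simp: pair_matching_def)
    moreover have "(\<exists>y. ml u = Some y \<and> lev y = None) \<or> lev v \<noteq> None" if uv: "(u, v) \<in> set es" for u v
    proof (rule ccontr)
      assume neg: "\<not> ((\<exists>y. ml u = Some y \<and> lev y = None) \<or> lev v \<noteq> None)"
      have u: "u \<in> L" "v \<in> set (adj u)" using uv es adj(1) by auto
      \<comment> \<open>An uncovered edge would start at a reachable \<open>u\<close>. Since layer
        \<open>d\<close> is empty, \<open>u\<close> lies in an earlier layer, which has been
        expanded.\<close>
      have "\<exists>i\<le>d. ldist ml lev u = Some i"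
      proof (cases "ml u")
        case (Some y)
        then obtain i where i: "lev y = Some i" using neg by auto
        have "i < d" using layered_right(1)[OF lay _ i] mates_left(2)[OF m u(1) Some] by blast
        then show ?thesis using Some i by (simp add: ldist_def)
      qed (simp add: ldist_def)
      then obtain i where i: "ldist ml lev u = Some i" "i \<le> d" by blast
      moreover have "i \<noteq> d" using no u(1) i by auto
      ultimately have "i < d" by simp
      from layered_left[OF lay u(1) i(1) this u(2)] neg show False by auto
    qed
    moreover have "card {u \<in> L. \<exists>v. ml u = Some v \<and> lev v = None} + card {v \<in> R. lev v \<noteq> None} = card M"
    proof -
      have "{u \<in> L. \<exists>v. ml u = Some v \<and> lev v = None}
          = {u \<in> L. \<exists>v. ml u = Some v \<and> v \<notin> {v \<in> R. lev v \<noteq> None}}"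
        using mates_left(2)[OF m] by auto
      then show ?thesis using card_cover[OF m, of "{v \<in> R. lev v \<noteq> None}"] reached M(2) by auto
    qed
    moreover have "steps (hopcroft_karp n ls rs es)
      \<le> (4 * length es + 10 * length ls + 2 * length rs + 14) * (s + n div s + 1)"
    proof -
      have "edge_count = length es"
      proof -
        have "edge_count = (\<Sum>u\<in>L. length (filter (\<lambda>e. fst e = u) es))"
          using dist(1) adj(2) by (simp add: edge_count_def sum_list_distinct_conv_sum_set)
        also have "\<dots> = length es" by (rule sum_length_filter_fst) (use es in auto)
        finally show ?thesis .
      qed
      then have pc: "phase_cost = 3 * length es + 8 * length ls + length rs + 6"
        by (simp add: phase_cost_def)
      have "steps (phases n n ls rs adj ml1 mr1)
          \<le> phase_cost * (s + min (card N - card (matched ml1)) (n div s) + 1)"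
        using ph by simp
      also have "\<dots> \<le> phase_cost * (s + n div s + 1)" by (intro mult_le_mono2) simp
      \<comment> \<open>The first summand is the cost of building \<open>adj\<close> and of
        initialising the mates; it is absorbed by a factor of at least 1.\<close>
      finally have "steps (hopcroft_karp n ls rs es)
          \<le> (length es + 2 * length ls + length rs + 8) * 1 + phase_cost * (s + n div s + 1)"
        by (simp add: hopcroft_karp_def adj_def ml1_def mr1_def)
      also have "\<dots> \<le> (length es + 2 * length ls + length rs + 8) * (s + n div s + 1)
          + phase_cost * (s + n div s + 1)"
        by (intro add_mono mult_le_mono2) auto
      also have "\<dots> = (4 * length es + 10 * length ls + 2 * length rs + 14) * (s + n div s + 1)"
        unfolding pc by (simp add: algebra_simps)
      finally show ?thesis .
    qed
    ultimately show ?thesis by blast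
  qed
  from * show "M \<subseteq> set es" "inj_on fst M" "inj_on snd M" by blast+
  from * show "\<And>u v. (u, v) \<in> set es \<Longrightarrow> (\<exists>y. ml u = Some y \<and> lev y = None) \<or> lev v \<noteq> None" by blast
  from * show
    "card {u \<in> set ls. \<exists>v. ml u = Some v \<and> lev v = None} + card {v \<in> set rs. lev v \<noteq> None} = card M"
    "steps (hopcroft_karp n ls rs es)
      \<le> (4 * length es + 10 * length ls + 2 * length rs + 14) * (s + n div s + 1)" by blast+
qed

section \<open>Optimality via vertex covers\<close>

text \<open>Weak duality: disjoint edges are covered by distinct vertices.\<close>

lemma card_matching_le_cover:
  assumes "matching E N" "finite C" "\<And>e. e \<in> E \<Longrightarrow> e \<inter> C \<noteq> {}"
  shows "card N \<le> card C"
proof -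
  have "\<exists>v. v \<in> e \<and> v \<in> C" if "e \<in> N" for e
  proof -
    have "e \<in> E" using that assms(1) by (auto simp: matching_def)
    from assms(3)[OF this] show ?thesis by auto
  qed
  then obtain g where g: "\<And>e. e \<in> N \<Longrightarrow> g e \<in> e \<and> g e \<in> C" by metis
  have "inj_on g N"
  proof (rule inj_onI)
    fix e f assume "e \<in> N" "f \<in> N" "g e = g f"
    then show "e = f" using g[of e] g[of f] assms(1) by (auto simp: matching_def)
  qed
  then show ?thesis using g assms(2) by (intro card_inj_on_le) auto
qed

lemma maximum_matching_cover:
  assumes "matching E M" "finite C" "\<And>e. e \<in> E \<Longrightarrow> e \<inter> C \<noteq> {}" "card C \<le> card M"
  shows "maximum (matching E) M"
  unfolding maximum_def
proof (intro conjI allI impI)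
  fix N assume "matching E N"
  then have "card N \<le> card C" using assms(2,3) by (rule card_matching_le_cover)
  then show "card N \<le> card M" using assms(4) by simp
qed fact

text \<open>The complement of an independent set is a vertex cover, so weak duality bounds its size
  from below.\<close>

lemma maximum_independent_cover:
  assumes V: "finite V" "\<And>e. e \<in> E \<Longrightarrow> e \<subseteq> V" and M: "matching E M"
    and C: "C \<subseteq> V" "\<And>e. e \<in> E \<Longrightarrow> e \<inter> C \<noteq> {}" "card C \<le> card M"
  shows "maximum (independent V E) (V - C)"
  unfolding maximum_def
proof (intro conjI allI impI)
  show "independent V E (V - C)"
    using C(2) by (auto simp: independent_def induced_edges_def)
  fix T assume T: "independent V E T"
  have "card M \<le> card (V - T)"
  proof (rule card_matching_le_cover[OF M])
    fix e assume "e \<in> E"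
    then show "e \<inter> (V - T) \<noteq> {}"
      using T V(2)[of e] by (force simp: independent_def induced_edges_def)
  qed (use V(1) in simp)
  moreover have TV: "T \<subseteq> V" using T by (simp add: independent_def)
  moreover have "card (V - T) = card V - card T" "card T \<le> card V"
    using TV V(1) by (auto simp: card_Diff_subset card_mono finite_subset)
  moreover have "card (V - C) = card V - card C"
    using C(1) V(1) by (auto simp: card_Diff_subset finite_subset)
  ultimately show "card T \<le> card (V - C)" using C(3) by linarith
qed

text \<open>The vertex names \<open>g\<close> admit vertices of any type, so that Koenig's theorem can be read off
  from a run of the algorithm.\<close>

lemma hopcroft_karp_graph:
  fixes g :: "nat \<Rightarrow> 'a"
  assumes dist: "distinct ls" "distinct rs" and es: "set es \<subseteq> set ls \<times> set rs"
    and n: "length ls + length rs \<le> n"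
    and run: "val (hopcroft_karp n ls rs es) = (lev, ml, mr)"
    and disj: "set ls \<inter> set rs = {}" and g: "inj_on g (set ls \<union> set rs)"
  defines "E \<equiv> (\<lambda>(u, v). {g u, g v}) ` set es"
    and "M \<equiv> (\<lambda>(u, v). {g u, g v}) ` {(u, v). u \<in> set ls \<and> ml u = Some v}"
    and "C \<equiv> g ` ({u \<in> set ls. \<exists>v. ml u = Some v \<and> lev v = None} \<union> {v \<in> set rs. lev v \<noteq> None})"
  shows "matching E M" "\<And>e. e \<in> E \<Longrightarrow> e \<inter> C \<noteq> {}" "finite C" "card C \<le> card M"
    and "E - M = (\<lambda>(u, v). {g u, g v}) ` set (filter (\<lambda>(u, v). ml u \<noteq> Some v) es)"
proof -
  define P where "P = {(u, v). u \<in> set ls \<and> ml u = Some v}"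
  \<comment> \<open>The threshold enters the step bound only, so the value 1 does for
    correctness.\<close>
  note hk = hopcroft_karp_pairs[OF dist es n zero_less_one run, folded P_def]
  have gD: "x = y" if "g x = g y" "x \<in> set ls \<union> set rs" "y \<in> set ls \<union> set rs" for x y
    using that g by (simp add: inj_on_eq_iff)
  have LR: "x \<noteq> y" if "x \<in> set ls" "y \<in> set rs" for x y using that disj by auto
  have edge_eq: "u = u' \<and> v = v'"
    if "{g u, g v} = {g u', g v'}" "u \<in> set ls" "u' \<in> set ls" "v \<in> set rs" "v' \<in> set rs" for u v u' v'
    using that(1) gD[of u u'] gD[of u v'] gD[of v v'] LR[of u v'] that(2-)
    by (auto simp: doubleton_eq_iff)
  have P: "u \<in> set ls" "v \<in> set rs" if "(u, v) \<in> P" for u v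
    using that hk(1) es by auto
  have inj: "inj_on (\<lambda>(u, v). {g u, g v}) (set ls \<times> set rs)"
    by (rule inj_onI) (use edge_eq in auto)
  show "matching E M"
    unfolding matching_def
  proof (intro conjI ballI impI)
    show "M \<subseteq> E" using hk(1) unfolding M_def E_def P_def[symmetric] by blast
    fix e f assume "e \<in> M" "f \<in> M" "e \<noteq> f"
    then obtain u v u' v' where e: "(u, v) \<in> P" "e = {g u, g v}" and f: "(u', v') \<in> P" "f = {g u', g v'}"
      unfolding M_def P_def[symmetric] by blast
    have "(u, v) \<noteq> (u', v')" using e f \<open>e \<noteq> f\<close> by auto
    then have "u \<noteq> u'" "v \<noteq> v'"
      using inj_onD[OF hk(2) _ e(1) f(1)] inj_onD[OF hk(3) _ e(1) f(1)] by auto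
    then have "g u \<noteq> g u'" "g v \<noteq> g v'" "g u \<noteq> g v'" "g v \<noteq> g u'"
      using gD P[OF e(1)] P[OF f(1)] LR by blast+
    then show "e \<inter> f = {}" using e f by auto
  qed
  show "e \<inter> C \<noteq> {}" if e: "e \<in> E" for e
  proof -
    obtain u v where uv: "(u, v) \<in> set es" "e = {g u, g v}" using e unfolding E_def by auto
    then have "u \<in> set ls" "v \<in> set rs" using es by auto
    then have "g u \<in> C \<or> g v \<in> C" using hk(4)[OF uv(1)] by (auto simp: C_def)
    then show ?thesis using uv by auto
  qed
  show "finite C" by (simp add: C_def)
  have "card M = card P"
    unfolding M_def P_def[symmetric] using hk(1) es by (intro card_image inj_on_subset[OF inj]) auto
  moreover have "card C \<le> card ({u \<in> set ls. \<exists>v. ml u = Some v \<and> lev v = None} \<union> {v \<in> set rs. lev v \<noteq> None})"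
    unfolding C_def by (intro card_image_le) simp
  moreover have "\<dots> \<le> card {u \<in> set ls. \<exists>v. ml u = Some v \<and> lev v = None} + card {v \<in> set rs. lev v \<noteq> None}"
    by (rule card_Un_le)
  ultimately show "card C \<le> card M" using hk(5) by simp
  have "E - M = (\<lambda>(u, v). {g u, g v}) ` (set es - P)"
    unfolding E_def M_def P_def[symmetric] using hk(1) es by (intro inj_on_image_set_diff[OF inj, symmetric]) auto
  also have "set es - P = set (filter (\<lambda>(u, v). ml u \<noteq> Some v) es)" using es by (auto simp: P_def)
  finally show "E - M = (\<lambda>(u, v). {g u, g v}) ` set (filter (\<lambda>(u, v). ml u \<noteq> Some v) es)" .
qed

text \<open>The vertices are numbered by \<open>f\<close>, Hopcroft--Karp is run on the numbered
  graph, and its matching and cover are carried back by \<open>g\<close>.\<close>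

lemma Koenig:
  assumes G: "simple_graph V E" and bip: "bipartite V E"
  obtains M C where "matching E M" "C \<subseteq> V" "\<And>e. e \<in> E \<Longrightarrow> e \<inter> C \<noteq> {}" "card C \<le> card M"
proof -
  obtain A B where AB: "bipartition V E A B" using bip by (auto simp: bipartite_def)
  then have AB': "A \<union> B = V" "A \<inter> B = {}" by (auto simp: bipartition_def)
  have fin: "finite V" using G by (simp add: simple_graph_def)
  obtain f :: "'a \<Rightarrow> nat" where f: "inj_on f V"
    using finite_imp_inj_to_nat_seg[OF fin] by blast
  define g where "g = inv_into V f"
  have gf: "g (f x) = x" if "x \<in> V" for x using that f by (simp add: g_def)
  have gj: "inj_on g (f ` V)" unfolding g_def by (rule inj_on_inv_into) simp
  have finAB: "finite A" "finite B" using AB'(1) fin by auto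
  obtain ls where ls: "set ls = f ` A" "distinct ls" using finite_distinct_list finAB(1) by (metis finite_imageI)
  obtain rs where rs: "set rs = f ` B" "distinct rs" using finite_distinct_list finAB(2) by (metis finite_imageI)
  define X where "X = {(f a, f b) | a b. a \<in> A \<and> b \<in> B \<and> {a, b} \<in> E}"
  have "X \<subseteq> f ` A \<times> f ` B" by (auto simp: X_def)
  moreover from this have "finite X" using finAB by (meson finite_SigmaI finite_imageI finite_subset)
  ultimately obtain es where es: "set es = X" "set es \<subseteq> set ls \<times> set rs"
    using ls rs finite_list[of X] by auto
  obtain lev ml mr where run: "val (hopcroft_karp (length ls + length rs) ls rs es) = (lev, ml, mr)"
    by (metis prod_cases3)
  have disj: "set ls \<inter> set rs = {}"
    using inj_on_image_Int[OF f, of A B] ls(1) rs(1) AB' by auto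
  have LRV: "set ls \<union> set rs = f ` V" using ls rs AB'(1) by auto
  have "inj_on g (set ls \<union> set rs)" using gj LRV by simp
  note hk = hopcroft_karp_graph[OF ls(2) rs(2) es(2) order_refl run disj this]
  have E: "(\<lambda>(u, v). {g u, g v}) ` set es = E"
  proof (intro equalityI subsetI)
    fix e assume "e \<in> (\<lambda>(u, v). {g u, g v}) ` set es"
    then obtain a b where "a \<in> A" "b \<in> B" "{a, b} \<in> E" "e = {g (f a), g (f b)}"
      by (auto simp: es(1) X_def)
    then show "e \<in> E" using gf AB'(1) by auto
  next
    fix e assume "e \<in> E"
    then obtain a b where "a \<in> A" "b \<in> B" "e = {a, b}" using AB by (auto simp: bipartition_def)
    then have "(f a, f b) \<in> set es" "e = {g (f a), g (f b)}"
      using \<open>e \<in> E\<close> gf AB'(1) by (auto simp: es(1) X_def)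
    then show "e \<in> (\<lambda>(u, v). {g u, g v}) ` set es" by force
  qed
  show thesis
  proof (rule that)
    show "g ` ({u \<in> set ls. \<exists>v. ml u = Some v \<and> lev v = None} \<union> {v \<in> set rs. lev v \<noteq> None}) \<subseteq> V"
    proof -
      have "g ` (set ls \<union> set rs) \<subseteq> V" unfolding LRV using gf by auto
      then show ?thesis by blast
    qed
  qed (use hk[unfolded E] in blast)+
qed

section \<open>Peeling\<close>

lemma simple_graph_finite_edges:
  assumes "simple_graph V E"
  shows "finite V" "finite E"
proof -
  show V: "finite V" using assms by (simp add: simple_graph_def)
  have "E \<subseteq> Pow V" using assms by (auto simp: simple_graph_def)
  then show "finite E" using V by (meson finite_Pow_iff finite_subset)
qed

lemma simple_graph_subset: "simple_graph V E \<Longrightarrow> E' \<subseteq> E \<Longrightarrow> simple_graph V E'"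
  by (auto simp: simple_graph_def)

lemma bipartition_subset: "bipartition V E A B \<Longrightarrow> E' \<subseteq> E \<Longrightarrow> bipartition V E' A B"
  unfolding bipartition_def by blast

lemma peel_subset: "peel i E E' \<Longrightarrow> E' \<subseteq> E"
  by (induction rule: peel.induct) auto

section \<open>The output is \<open>k\<close>-dependent\<close>

lemma matching_at_most_one:
  assumes "matching E M"
  shows "card {e \<in> M. v \<in> e} \<le> 1"
proof -
  have "\<forall>e\<in>{e \<in> M. v \<in> e}. \<forall>f\<in>{e \<in> M. v \<in> e}. e = f"
    using assms by (auto simp: matching_def)
  then show ?thesis
    using card_le_Suc0_iff_eq[of "{e \<in> M. v \<in> e}"]
    by (cases "finite {e \<in> M. v \<in> e}") simp_all
qed

text \<open>The deleted edges form \<open>i\<close> matchings, each with at most one edge at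
  \<open>v\<close>.\<close>

lemma peel_degree:
  assumes "peel i E E'" "finite E"
  shows "card {e \<in> E - E'. v \<in> e} \<le> i"
  using assms
proof (induction rule: peel.induct)
  case (peel_0 E)
  then show ?case by simp
next
  case (peel_Suc E M i E')
  have M: "matching E M" using peel_Suc.hyps(1) by (simp add: maximum_def)
  have "{e \<in> E - E'. v \<in> e} \<subseteq> {e \<in> M. v \<in> e} \<union> {e \<in> E - M - E'. v \<in> e}" by blast
  moreover have "finite M" using M peel_Suc.prems by (meson finite_subset matching_def)
  ultimately have "card {e \<in> E - E'. v \<in> e} \<le> card ({e \<in> M. v \<in> e} \<union> {e \<in> E - M - E'. v \<in> e})"
    using peel_Suc.prems by (intro card_mono) auto
  also have "\<dots> \<le> card {e \<in> M. v \<in> e} + card {e \<in> E - M - E'. v \<in> e}" by (rule card_Un_le)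
  also have "\<dots> \<le> 1 + i"
    using matching_at_most_one[OF M] peel_Suc.IH peel_Suc.prems by (intro add_mono) auto
  finally show ?case by simp
qed

lemma algorithm_output_k_dependent:
  assumes "simple_graph V E" "algorithm_output k V E S"
  shows "k_dependent k V E S"
proof -
  obtain E' where p: "peel k E E'" and S: "independent V E' S"
    using assms(2) by (auto simp: algorithm_output_def maximum_def)
  have fin: "finite E" using assms(1) by (rule simple_graph_finite_edges)
  have "degree (induced_edges E S) v \<le> k" for v
  proof -
    \<comment> \<open>\<open>S\<close> is independent in the residual graph, so all edges inside it
      have been deleted.\<close>
    have "{e \<in> induced_edges E S. v \<in> e} \<subseteq> {e \<in> E - E'. v \<in> e}"
      using S by (auto simp: independent_def induced_edges_def)
    then have "degree (induced_edges E S) v \<le> card {e \<in> E - E'. v \<in> e}"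
      unfolding degree_def using fin by (intro card_mono) auto
    then show ?thesis using peel_degree[OF p fin, of v] by simp
  qed
  then show ?thesis using S by (auto simp: k_dependent_def independent_def)
qed

text \<open>Division by 0 gives 0 in HOL; nonemptiness of the output ensures that the ratio is a
  genuine quotient. A single vertex is independent since edges have two ends.\<close>

lemma maximum_independent_nonempty:
  assumes "simple_graph V E" "maximum (independent V E) S" "V \<noteq> {}"
  shows "S \<noteq> {}"
proof
  assume "S = {}"
  obtain v where v: "v \<in> V" using assms(3) by blast
  have "induced_edges E {v} = {}"
  proof -
    have False if "e \<in> E" "e \<subseteq> {v}" for e
      using that assms(1) card_mono[of "{v}" e] by (auto simp: simple_graph_def)
    then show ?thesis by (auto simp: induced_edges_def)
  qed
  then have "independent V E {v}" using v by (simp add: independent_def)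
  then have "card {v} \<le> card S" using assms(2) unfolding maximum_def by blast
  then show False using \<open>S = {}\<close> by simp
qed

section \<open>The approximation ratio\<close>

lemma matching_inside:
  assumes "simple_graph V E" "matching E M"
  shows "card M \<le> card (induced_edges M I) + card (V - I)"
proof -
  have "M \<subseteq> E" using assms(2) by (simp add: matching_def)
  then have fin: "finite M" "finite V"
    using simple_graph_finite_edges[OF assms(1)] by (auto intro: finite_subset)
  \<comment> \<open>An edge of \<open>M\<close> not inside \<open>I\<close> has an end outside of
    it, and disjoint edges have different ones.\<close>
  have "\<exists>v. v \<in> e \<and> v \<in> V - I" if "e \<in> M - induced_edges M I" for e
    using that assms by (auto simp: induced_edges_def simple_graph_def matching_def)
  then obtain g where g: "\<And>e. e \<in> M - induced_edges M I \<Longrightarrow> g e \<in> e \<and> g e \<in> V - I" by metis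
  have "inj_on g (M - induced_edges M I)"
  proof (rule inj_onI)
    fix e f assume "e \<in> M - induced_edges M I" "f \<in> M - induced_edges M I" "g e = g f"
    then show "e = f" using g[of e] g[of f] assms(2) by (auto simp: matching_def)
  qed
  then have "card (M - induced_edges M I) \<le> card (V - I)"
    using g fin by (intro card_inj_on_le) auto
  moreover have "card (M - induced_edges M I) = card M - card (induced_edges M I)"
    using fin by (intro card_Diff_subset) (auto simp: induced_edges_def)
  ultimately show ?thesis by simp
qed

text \<open>Each of the \<open>i\<close> deleted matchings is at least as large as \<open>N\<close>.\<close>

lemma peel_induced_edges:
  assumes "peel i E E'" "simple_graph V E" "matching E' N"
  shows "card (induced_edges E' I) + i * (card N - card (V - I)) \<le> card (induced_edges E I)"
  using assms
proof (induction rule: peel.induct)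
  case (peel_0 E)
  then show ?case by simp
next
  case (peel_Suc E M i E')
  have M: "matching E M" and max: "\<And>Y. matching E Y \<Longrightarrow> card Y \<le> card M"
    using peel_Suc.hyps(1) by (auto simp: maximum_def)
  have fin: "finite E" using peel_Suc.prems(1) by (rule simple_graph_finite_edges)
  have ME: "M \<subseteq> E" using M by (simp add: matching_def)
  have "matching E N"
    using peel_Suc.prems(2) peel_subset[OF peel_Suc.hyps(2)] by (auto simp: matching_def)
  then have "card N \<le> card M" by (rule max)
  also have "\<dots> \<le> card (induced_edges M I) + card (V - I)"
    using peel_Suc.prems(1) M by (rule matching_inside)
  finally have 1: "card N - card (V - I) \<le> card (induced_edges M I)" by simp
  have "induced_edges E I = induced_edges (E - M) I \<union> induced_edges M I"
    using ME by (auto simp: induced_edges_def)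
  moreover have "card (induced_edges (E - M) I \<union> induced_edges M I)
      = card (induced_edges (E - M) I) + card (induced_edges M I)"
    using fin ME by (intro card_Un_disjoint) (auto simp: induced_edges_def intro: finite_subset)
  moreover have "card (induced_edges E' I) + i * (card N - card (V - I))
      \<le> card (induced_edges (E - M) I)"
    using peel_Suc.IH peel_Suc.prems simple_graph_subset by blast
  ultimately show ?case using 1 by simp
qed

text \<open>Double counting of incidences between \<open>I\<close> and its induced edges.\<close>

lemma k_dependent_edges:
  assumes "simple_graph V E" "k_dependent k V E I"
  shows "2 * card (induced_edges E I) \<le> k * card I"
proof -
  let ?F = "induced_edges E I"
  have fin: "finite I" "finite ?F"
    using assms simple_graph_finite_edges[OF assms(1)]
    by (auto simp: k_dependent_def induced_edges_def intro: finite_subset)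
  have two: "card {v \<in> I. v \<in> e} = 2" if "e \<in> ?F" for e
  proof -
    have "{v \<in> I. v \<in> e} = e" using that by (auto simp: induced_edges_def)
    then show ?thesis using that assms(1) by (auto simp: induced_edges_def simple_graph_def)
  qed
  have "2 * card ?F = (\<Sum>e\<in>?F. card {v \<in> I. v \<in> e})" using two by simp
  also have "\<dots> = (\<Sum>e\<in>?F. \<Sum>v\<in>I. if v \<in> e then 1 else 0)"
    using fin by (simp add: sum.If_cases Int_def)
  also have "\<dots> = (\<Sum>v\<in>I. \<Sum>e\<in>?F. if v \<in> e then 1 else 0)" by (rule sum.swap)
  also have "\<dots> = (\<Sum>v\<in>I. degree ?F v)"
    using fin by (simp add: sum.If_cases degree_def Int_def)
  also have "\<dots> \<le> (\<Sum>v\<in>I. k)"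
    using assms(2) by (intro sum_mono) (auto simp: k_dependent_def)
  finally show ?thesis by (simp add: mult.commute)
qed

text \<open>The residual matching \<open>N\<close> acts as one more round, which gives the factor
  \<open>k + 1\<close>. The hypothesis on \<open>S\<close> is what Koenig's theorem provides for a
  maximum independent set of the residual graph.\<close>

lemma k_dependent_ratio:
  fixes k :: nat
  assumes G: "simple_graph V E" and p: "peel k E E'" and N: "matching E' N"
    and S: "card V \<le> card S + card N" and I: "k_dependent k V E I"
  shows "real (card I) / real (card S) \<le> 1 + real k / (real k + 2)"
proof -
  have G': "simple_graph V E'" using G peel_subset[OF p] by (rule simple_graph_subset)
  have fin: "finite V" "finite E'" using G G' simple_graph_finite_edges by auto
  have IV: "I \<subseteq> V" using I by (simp add: k_dependent_def)
  have "card (induced_edges N I) \<le> card (induced_edges E' I)"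
    using N fin by (intro card_mono) (auto simp: induced_edges_def matching_def)
  then have "card N - card (V - I) \<le> card (induced_edges E' I)"
    using matching_inside[OF G' N, of I] by simp
  then have "(k + 1) * (card N - card (V - I)) \<le> card (induced_edges E I)"
    using peel_induced_edges[OF p G N, of I] by simp
  then have "2 * ((k + 1) * (card N - card (V - I))) \<le> k * card I"
    using k_dependent_edges[OF G I] by linarith
  then have 1: "2 * ((real k + 1) * real (card N - card (V - I))) \<le> real k * real (card I)"
    by (metis (mono_tags) of_nat_1 of_nat_add of_nat_le_iff of_nat_mult of_nat_numeral)
  have "card (V - I) = card V - card I" "card I \<le> card V"
    using IV fin by (auto simp: card_Diff_subset card_mono finite_subset)
  \<comment> \<open>Subtraction on natural numbers is truncated, so the right-hand side is at least
    the real difference, which is \<open>|N| - |V| + |I|\<close>.\<close>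
  then have "real (card I) - real (card S) \<le> real (card N - card (V - I))" using S by linarith
  then have "2 * ((real k + 1) * (real (card I) - real (card S)))
      \<le> 2 * ((real k + 1) * real (card N - card (V - I)))"
    by (intro mult_left_mono) auto
  then have 2: "real (card I) * (real k + 2) \<le> (2 * real k + 2) * real (card S)"
    using 1 by (simp add: algebra_simps)
  show ?thesis
  proof (cases "card S = 0")
    case False
    have "1 + real k / (real k + 2) = (2 * real k + 2) / (real k + 2)" by (simp add: field_simps)
    then show ?thesis using 2 False by (simp add: divide_simps mult.commute split: if_splits)
  qed simp
qed

section \<open>Correctness and running time of the implementation\<close>

lemma peel_edges:
  assumes dist: "distinct ls" "distinct rs" and es: "set es \<subseteq> set ls \<times> set rs"
    and n: "length ls + length rs \<le> n" and s: "0 < s" and disj: "set ls \<inter> set rs = {}"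
    and m: "length es \<le> m" "length ls \<le> m" "length rs \<le> m" "1 \<le> m"
  shows "peel k ((\<lambda>(u, v). {u, v}) ` set es)
      ((\<lambda>(u, v). {u, v}) ` set (val (peel_edges k n ls rs es))) \<and>
    set (val (peel_edges k n ls rs es)) \<subseteq> set es \<and>
    length (val (peel_edges k n ls rs es)) \<le> length es \<and>
    steps (peel_edges k n ls rs es) \<le> 33 * k * (m * (s + n div s + 1)) + 1"
  using es m(1)
\<comment> \<open>\<open>m\<close> is fixed and bounds all lengths, so the bound per round stays the
  same while \<open>es\<close> shrinks.\<close>
proof (induction k arbitrary: es)
  case 0
  then show ?case by (simp add: peel_0)
next
  case (Suc k)
  obtain lev ml mr where run: "val (hopcroft_karp n ls rs es) = (lev, ml, mr)"
    by (metis prod_cases3)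
  have "inj_on (\<lambda>x. x) (set ls \<union> set rs)" by simp
  note hk = hopcroft_karp_graph[OF dist Suc.prems(1) n run disj this]
  define es' where "es' = filter (\<lambda>(u, v). ml u \<noteq> Some v) es"
  have sub: "set es' \<subseteq> set es" and len: "length es' \<le> length es" by (auto simp: es'_def)
  have IH: "peel k ((\<lambda>(u, v). {u, v}) ` set es')
      ((\<lambda>(u, v). {u, v}) ` set (val (peel_edges k n ls rs es'))) \<and>
    set (val (peel_edges k n ls rs es')) \<subseteq> set es' \<and>
    length (val (peel_edges k n ls rs es')) \<le> length es' \<and>
    steps (peel_edges k n ls rs es') \<le> 33 * k * (m * (s + n div s + 1)) + 1"
    using Suc.IH[of es'] sub len Suc.prems by auto
  have run': "val (peel_edges (Suc k) n ls rs es) = val (peel_edges k n ls rs es')"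
    using run by (simp add: es'_def)
  have "peel (Suc k) ((\<lambda>(u, v). {u, v}) ` set es)
      ((\<lambda>(u, v). {u, v}) ` set (val (peel_edges k n ls rs es')))"
    using maximum_matching_cover[OF hk(1,3,2,4)] IH[THEN conjunct1]
    unfolding es'_def hk(5)[symmetric] by (rule peel_Suc)
  moreover have "steps (peel_edges (Suc k) n ls rs es) \<le> 33 * Suc k * (m * (s + n div s + 1)) + 1"
  proof -
    have "steps (hopcroft_karp n ls rs es)
        \<le> (4 * length es + 10 * length ls + 2 * length rs + 14) * (s + n div s + 1)"
      by (rule hopcroft_karp_pairs(6)[OF dist Suc.prems(1) n s run])
    \<comment> \<open>\<open>30 = 4 + 10 + 2 + 14\<close>, as all lengths and 1 are at most
      \<open>m\<close>.\<close>
    also have "\<dots> \<le> (30 * m) * (s + n div s + 1)"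
      using m Suc.prems(2) by (intro mult_le_mono1) linarith
    finally have hk_st: "steps (hopcroft_karp n ls rs es) \<le> 30 * (m * (s + n div s + 1))"
      by (simp only: mult.assoc)
    have "length es + 2 \<le> 3 * (m * 1)" using Suc.prems(2) m(4) by simp
    also have "\<dots> \<le> 3 * (m * (s + n div s + 1))" by (intro mult_le_mono2) simp
    finally have "length es + 2 \<le> 3 * (m * (s + n div s + 1))" .
    moreover have "steps (peel_edges (Suc k) n ls rs es)
        = steps (hopcroft_karp n ls rs es) + (length es + 2) + steps (peel_edges k n ls rs es')"
      using run by (simp add: es'_def)
    moreover have "steps (peel_edges k n ls rs es') \<le> 33 * k * (m * (s + n div s + 1)) + 1"
      using IH by blast
    moreover have "33 * Suc k * (m * (s + n div s + 1))
        = 30 * (m * (s + n div s + 1)) + 3 * (m * (s + n div s + 1)) + 33 * k * (m * (s + n div s + 1))"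
      by (simp only: mult_Suc_right distrib_right)
    ultimately show ?thesis using hk_st by linarith
  qed
  ultimately show ?case using IH sub len unfolding run' by auto
qed

text \<open>Koenig's theorem for the residual graph gives a cover no larger than a matching
  \<open>N\<close>; its complement is independent, so \<open>S\<close> misses at most
  \<open>card N\<close> vertices.\<close>

lemma algorithm_output_ratio:
  assumes G: "simple_graph V E" and bip: "bipartite V E" and out: "algorithm_output k V E S"
    and I: "k_dependent k V E I"
  shows "real (card I) / real (card S) \<le> 1 + real k / (real k + 2)"
proof -
  obtain E' where p: "peel k E E'" and S: "maximum (independent V E') S"
    using out by (auto simp: algorithm_output_def)
  have sub: "E' \<subseteq> E" using p by (rule peel_subset)
  have G': "simple_graph V E'" using G sub by (rule simple_graph_subset)
  have "bipartite V E'" using bip sub bipartition_subset unfolding bipartite_def by blast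
  then obtain N C where N: "matching E' N" and C: "C \<subseteq> V" "\<And>e. e \<in> E' \<Longrightarrow> e \<inter> C \<noteq> {}" "card C \<le> card N"
    using Koenig[OF G'] by blast
  have fin: "finite V" using G by (simp add: simple_graph_def)
  have "independent V E' (V - C)"
    using maximum_independent_cover[OF fin _ N C] G' by (auto simp: maximum_def simple_graph_def)
  then have "card (V - C) \<le> card S" using S by (simp add: maximum_def)
  moreover have "card V = card (V - C) + card C"
    using C(1) fin by (metis add.commute card_Diff_subset card_mono finite_subset le_add_diff_inverse)
  ultimately have "card V \<le> card S + card N" using C(3) by simp
  with G p N show ?thesis using I by (rule k_dependent_ratio)
qed

lemma peeling_algorithm:
  assumes G: "simple_graph V E" and AB: "bipartition V E A B" and el: "edge_list A B E es"
  shows "algorithm_output k V E {v. val (peeling_algorithm k (card V) (\<lambda>v. v \<in> V) es) v}"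
    and "0 < s \<Longrightarrow> es \<noteq> [] \<Longrightarrow> 1 \<le> k \<Longrightarrow> steps (peeling_algorithm k (card V) (\<lambda>v. v \<in> V) es)
      \<le> 85 * k * (length es * (s + card V div s + 1))"
proof -
  let ?n = "card V"
  define ls where "ls = val (dedup (map fst es))"
  define rs where "rs = val (dedup (map snd es))"
  have ls: "set ls = fst ` set es" "distinct ls" "length ls \<le> length es"
    using dedup[of "map fst es"] by (auto simp: ls_def)
  have rs: "set rs = snd ` set es" "distinct rs" "length rs \<le> length es"
    using dedup[of "map snd es"] by (auto simp: rs_def)
  have E: "E = (\<lambda>(u, v). {u, v}) ` set es" "set es \<subseteq> A \<times> B" using el by (auto simp: edge_list_def)
  have V: "A \<union> B = V" "A \<inter> B = {}" "finite V" using AB G by (auto simp: bipartition_def simple_graph_def)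
  have lsA: "set ls \<subseteq> A" and rsB: "set rs \<subseteq> B" using ls rs E(2) by auto
  have es: "set es \<subseteq> set ls \<times> set rs" using ls rs by force
  have disj: "set ls \<inter> set rs = {}" using lsA rsB V by auto
  have n: "length ls + length rs \<le> ?n"
  proof -
    have "length ls + length rs = card (set ls \<union> set rs)"
      using ls(2) rs(2) disj by (simp add: card_Un_disjoint distinct_card)
    also have "\<dots> \<le> ?n" using lsA rsB V by (intro card_mono) auto
    finally show ?thesis .
  qed
  define es' where "es' = val (peel_edges k ?n ls rs es)"
  obtain lev ml mr where run: "val (hopcroft_karp ?n ls rs es') = (lev, ml, mr)"
    by (metis prod_cases3)
  \<comment> \<open>With \<open>Suc (length es)\<close> for \<open>m\<close>, the requirement
    \<open>1 \<le> m\<close> also holds for empty \<open>es\<close>.\<close>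
  have peel: "peel k E ((\<lambda>(u, v). {u, v}) ` set es')" and sub: "set es' \<subseteq> set es"
    and len: "length es' \<le> length es"
    using peel_edges[OF ls(2) rs(2) es n zero_less_one disj, of "Suc (length es)" k] ls(3) rs(3)
    by (simp_all add: es'_def E(1))
  have es'': "set es' \<subseteq> set ls \<times> set rs" using sub es by blast
  have "inj_on (\<lambda>x. x) (set ls \<union> set rs)" by simp
  note hk = hopcroft_karp_graph[OF ls(2) rs(2) es'' n run disj this]
  \<comment> \<open>The image under the identity keeps \<open>?C\<close> in the form of the cover in
    \<open>hk\<close>.\<close>
  let ?C = "(\<lambda>x. x) ` ({u \<in> set ls. \<exists>v. ml u = Some v \<and> lev v = None} \<union> {v \<in> set rs. lev v \<noteq> None})"
  have S: "{v. val (peeling_algorithm k ?n (\<lambda>v. v \<in> V) es) v} = V - ?C"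
    using run by (auto simp: peeling_algorithm_def remove_left_cover(1) remove_right_cover(1)
        ls_def[symmetric] rs_def[symmetric] es'_def[symmetric])
  have "maximum (independent V ((\<lambda>(u, v). {u, v}) ` set es')) (V - ?C)"
  proof (rule maximum_independent_cover[OF V(3) _ hk(1) _ hk(2,4)])
    show "e \<subseteq> V" if "e \<in> (\<lambda>(u, v). {u, v}) ` set es'" for e
      using that sub E(2) V(1) by auto
    show "?C \<subseteq> V" using lsA rsB V(1) by auto
  qed
  then show "algorithm_output k V E {v. val (peeling_algorithm k ?n (\<lambda>v. v \<in> V) es) v}"
    using peel unfolding algorithm_output_def S by blast
  show "steps (peeling_algorithm k ?n (\<lambda>v. v \<in> V) es) \<le> 85 * k * (length es * (s + ?n div s + 1))"
    if s: "0 < s" and ne: "es \<noteq> []" and k: "1 \<le> k"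
  proof -
    define T where "T = length es * (s + ?n div s + 1)"
    have m: "1 \<le> length es" using ne by (simp add: Suc_leI)
    have "steps (hopcroft_karp ?n ls rs es')
        \<le> (4 * length es' + 10 * length ls + 2 * length rs + 14) * (s + ?n div s + 1)"
      by (rule hopcroft_karp_pairs(6)[OF ls(2) rs(2) es'' n s run])
    also have "\<dots> \<le> (30 * length es) * (s + ?n div s + 1)"
      using m ls(3) rs(3) len by (intro mult_le_mono1) linarith
    finally have 1: "steps (hopcroft_karp ?n ls rs es') \<le> 30 * T"
      by (simp only: T_def mult.assoc)
    have 2: "steps (peel_edges k ?n ls rs es) \<le> 33 * k * T + 1"
      using peel_edges[OF ls(2) rs(2) es n s disj order_refl ls(3) rs(3) m, of k] by (simp add: T_def)
    have 3: "length es \<le> T" by (simp add: T_def)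
    have "steps (peeling_algorithm k ?n (\<lambda>v. v \<in> V) es) = 6 * length es + 13 + length ls + length rs
        + steps (peel_edges k ?n ls rs es) + steps (hopcroft_karp ?n ls rs es')"
      using run by (simp add: peeling_algorithm_def remove_left_cover(2) remove_right_cover(2) dedup(4)
        ls_def[symmetric] rs_def[symmetric] es'_def[symmetric])
    \<comment> \<open>Here \<open>52 = 30 + 22\<close>, where \<open>22 = 6 + 13 + 1 + 1 + 1\<close>
      collects the linear passes and the constants.\<close>
    also have "\<dots> \<le> 33 * k * T + 52 * T" using 1 2 3 m ls(3) rs(3) by linarith
    also have "\<dots> \<le> 33 * k * T + 52 * k * T" using k by simp
    finally show ?thesis by (simp add: T_def)
  qed
qed

text \<open>Rounding up the square root of \<open>n\<close> balances \<open>s\<close> against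
  \<open>n div s\<close>; both are then about the root, and the additive constants are absorbed
  because the root is at least 1.\<close>

lemma sqrt_split:
  assumes "1 \<le> n"
  obtains s :: nat where "0 < s" "real (s + n div s + 1) \<le> 4 * sqrt (real n)"
proof -
  define s where "s = nat \<lceil>sqrt (real n)\<rceil>"
  have r: "1 \<le> sqrt (real n)" using assms by simp
  have s: "sqrt (real n) \<le> real s" "real s \<le> sqrt (real n) + 1" unfolding s_def using r by linarith+
  have "real (n div s) \<le> real n / real s" by (rule of_nat_div_le_of_nat)
  also have "\<dots> \<le> real n / sqrt (real n)" using s(1) r by (intro divide_left_mono mult_pos_pos) linarith+
  also have "\<dots> = sqrt (real n)" by (simp add: real_div_sqrt)
  finally have "real (s + n div s + 1) \<le> 4 * sqrt (real n)"
    using s(2) r unfolding of_nat_add of_nat_1 by linarith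
  moreover have "0 < s" using s(1) r by linarith
  ultimately show thesis using that by blast
qed

theorem theorem1:
  shows "(\<forall>(k::nat) (V::'a set) E S.
            1 \<le> k \<and> simple_graph V E \<and> bipartite V E \<and> algorithm_output k V E S \<longrightarrow>
              k_dependent k V E S \<and>
              (V \<noteq> {} \<longrightarrow> S \<noteq> {}) \<and>
              (\<forall>I. maximum (k_dependent k V E) I \<longrightarrow>
                 real (card I) / real (card S) \<le> 1 + real k / (real k + 2))) \<and>
         (\<exists>C::real. \<forall>(k::nat) (V::nat set) E A B es.
            1 \<le> k \<and> simple_graph V E \<and> bipartition V E A B \<and> edge_list A B E es \<longrightarrow>
              (let run = peeling_algorithm k (card V) (\<lambda>v. v \<in> V) es in
                 algorithm_output k V E {v. val run v} \<and>
                 (E \<noteq> {} \<longrightarrow>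
                    real (steps run) \<le> C * real k * real (card E) * sqrt (real (card V)))))"
proof
  show "\<forall>(k::nat) (V::'a set) E S.
      1 \<le> k \<and> simple_graph V E \<and> bipartite V E \<and> algorithm_output k V E S \<longrightarrow>
        k_dependent k V E S \<and> (V \<noteq> {} \<longrightarrow> S \<noteq> {}) \<and>
        (\<forall>I. maximum (k_dependent k V E) I \<longrightarrow>
           real (card I) / real (card S) \<le> 1 + real k / (real k + 2))"
  proof (intro allI impI conjI)
    fix k and V :: "'a set" and E S
    assume *: "1 \<le> k \<and> simple_graph V E \<and> bipartite V E \<and> algorithm_output k V E S"
    then show "k_dependent k V E S" using algorithm_output_k_dependent by blast
    show "S \<noteq> {}" if V: "V \<noteq> {}"
    proof -
      obtain E' where E': "peel k E E'" "maximum (independent V E') S"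
        using * by (auto simp: algorithm_output_def)
      have "simple_graph V E'" using simple_graph_subset[OF _ peel_subset[OF E'(1)]] * by blast
      then show ?thesis using E'(2) V by (rule maximum_independent_nonempty)
    qed
    show "real (card I) / real (card S) \<le> 1 + real k / (real k + 2)"
      if "maximum (k_dependent k V E) I" for I
    proof (rule algorithm_output_ratio)
      show "k_dependent k V E I" using that by (simp add: maximum_def)
    qed (use * in auto)
  qed
next
  \<comment> \<open>\<open>340 = 85 * 4\<close>, combining the bound for general \<open>s\<close>
    with the choice of \<open>s\<close>.\<close>
  have bound: "real (steps (peeling_algorithm k (card V) (\<lambda>v. v \<in> V) es))
      \<le> 340 * real k * real (card E) * sqrt (real (card V))"
    if k: "1 \<le> k" and G: "simple_graph V E" "bipartition V E A B" "edge_list A B E es" and "E \<noteq> {}"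
    for k and V :: "nat set" and E A B es
  proof -
    have es: "distinct es" "set es \<subseteq> A \<times> B" "E = (\<lambda>(u, v). {u, v}) ` set es"
      using G(3) by (auto simp: edge_list_def)
    have "A \<inter> B = {}" using G(2) by (simp add: bipartition_def)
    \<comment> \<open>The colour classes are disjoint, so distinct listed pairs are distinct edges
      and the list length is the number of edges.\<close>
    then have "inj_on (\<lambda>(u, v). {u, v}) (A \<times> B)" by (auto simp: inj_on_def doubleton_eq_iff)
    then have "card E = length es"
      using es by (simp add: card_image inj_on_subset distinct_card)
    have "es \<noteq> []" using \<open>E \<noteq> {}\<close> es(3) by auto
    have "V \<noteq> {}" using \<open>E \<noteq> {}\<close> G(1) by (auto simp: simple_graph_def)
    then have "1 \<le> card V" using G(1) by (simp add: simple_graph_def Suc_le_eq card_gt_0_iff)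
    then obtain s where s: "0 < s" "real (s + card V div s + 1) \<le> 4 * sqrt (real (card V))"
      by (rule sqrt_split)
    have "real (steps (peeling_algorithm k (card V) (\<lambda>v. v \<in> V) es))
        \<le> real (85 * k * (length es * (s + card V div s + 1)))"
      using peeling_algorithm(2)[OF G s(1) \<open>es \<noteq> []\<close> k] by (simp only: of_nat_le_iff)
    also have "\<dots> = 85 * real k * real (length es) * real (s + card V div s + 1)"
      by (simp only: of_nat_mult of_nat_numeral mult.assoc)
    also have "\<dots> \<le> 85 * real k * real (length es) * (4 * sqrt (real (card V)))"
      using s(2) by (intro mult_left_mono) auto
    finally show ?thesis using \<open>card E = length es\<close> by simp
  qed
  show "\<exists>C::real. \<forall>(k::nat) (V::nat set) E A B es.
      1 \<le> k \<and> simple_graph V E \<and> bipartition V E A B \<and> edge_list A B E es \<longrightarrow>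
        (let run = peeling_algorithm k (card V) (\<lambda>v. v \<in> V) es in
           algorithm_output k V E {v. val run v} \<and>
           (E \<noteq> {} \<longrightarrow> real (steps run) \<le> C * real k * real (card E) * sqrt (real (card V))))"
    unfolding Let_def using peeling_algorithm(1) bound by blast
qed

end
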